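(* Let $A=\mathbb{C}[\partial]V$ be an associative conformal algebra which is a free $\mathbb{C}[\partial]$-module, and let $Q=\mathbb{C}[\partial]x$ be a free $\mathbb{C}[\partial]$-module of rank 1. Then there is a bijection between the set $\mathcal{TC}(A,Q)$ of all associative conformal extending structures of $A$ by $Q$ and the set $\mathcal{FAC}(A)$ of all flag datums of $A$.
   Context: An associative conformal algebra is a $\mathbb{C}[\partial]$-module $A$ with a $\mathbb{C}$-bilinear $\lambda$-product $A\times A\to A[\lambda]$, $(a,b)\mapsto a_\lambda b$, such that $(\partial a)_\lambda b=-\lambda a_\lambda b$, $a_\lambda\partial b=(\lambda+\partial)a_\lambda b$ and $a_\lambda(b_\mu c)=(a_\lambda b)_{\lambda+\mu}c$. All maps are extended coefficientwise to polynomials in $\lambda,\mu$. $A=\mathbb{C}[\partial]V$ free means $A\cong\mathbb{C}[\partial]\otimes V$ for a vector space $V$. For $\mathbb{C}[\partial]$-modules $U,V$, a left conformal linear map is a $\mathbb{C}$-linear map $a_\lambda:U\to V[\lambda]$ with $a_\lambda(\partial u)=-\lambda a_\lambda u$; a (right) conformal linear map is one with $a_\lambda(\partial u)=(\partial+\lambda)a_\lambda u$. (Here $\mathbb{C}[\lambda,\partial]=(\mathbb{C}[\partial])[\lambda]$.) A conformal bilinear map $f_\lambda:U\times V\to W[\lambda]$ is a $\mathbb{C}$-bilinear map with $f_\lambda(\partial u,v)=-\lambda f_\lambda(u,v)$, $f_\lambda(u,\partial v)=(\partial+\lambda)f_\lambda(u,v)$. An extending datum of $A$ by $Q$ is a system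 $\Omega(A,Q)=(\leftharpoonup_\lambda,\rightharpoonup_\lambda,\lhd_\lambda,\rhd_\lambda,f_\lambda,\circ_\lambda)$ of conformal bilinear maps $\leftharpoonup_\lambda:A\times Q\to A[\lambda]$, $\rightharpoonup_\lambda:A\times Q\to Q[\lambda]$, $\lhd_\lambda:Q\times A\to Q[\lambda]$, $\rhd_\lambda:Q\times A\to A[\lambda]$, $f_\lambda:Q\times Q\to A[\lambda]$, $\circ_\lambda:Q\times Q\to Q[\lambda]$. It is an associative conformal extending structure if the $\lambda$-product $(a,y)_\lambda(b,z)=(a_\lambda b+a\leftharpoonup_\lambda z+y\rhd_\lambda b+f_\lambda(y,z),\ a\rightharpoonup_\lambda z+y\lhd_\lambda b+y\circ_\lambda z)$ makes the $\mathbb{C}[\partial]$-module $A\times Q$ an associative conformal algebra. A flag datum of $A=\mathbb{C}[\partial]V$ is a 6-tuple $(h_\lambda(\cdot,\partial),D_\lambda,g_\lambda(\cdot,\partial),T_\lambda,Q_0(\lambda,\partial),P(\lambda,\partial))$ where $P(\lambda,\partial)\in\mathbb{C}[\lambda,\partial]$, $Q_0(\lambda,\partial)\in A[\lambda]$, $h_\lambda(\cdot,\partial):A\to\mathbb{C}[\lambda,\partial]$ and $D_\lambda:A\to A[\lambda]$ are left conformal linear maps, $g_\lambda(\cdot,\partial):A\to\mathbb{C}[\lambda,\partial]$ and $T_\lambda:A\to A[\lambda]$ are conformal linear maps, such that for all $a,b\in V$: 1. $D_{\lambda+\mu}(a_\lambda b)=a_\lambda(D_\mu(b))+h_\mu(b,\lambda+\partial)D_\lambda(a)$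 2. $h_\mu(b,\lambda+\partial)h_\lambda(a,\partial)=h_{\lambda+\mu}(a_\lambda b,\partial)$ 3. $a_\lambda(T_\mu(b))+g_\mu(b,\lambda+\partial)D_\lambda(a)=(D_\lambda(a))_{\lambda+\mu}b+h_\lambda(a,-\lambda-\mu)T_{\lambda+\mu}(b)$ 4. $g_\mu(b,\lambda+\partial)h_\lambda(a,\partial)=h_\lambda(a,-\lambda-\mu)g_{\lambda+\mu}(b,\partial)$ 5. $T_\lambda(a_\mu b)=(T_\lambda(a))_{\lambda+\mu}b+g_\lambda(a,-\lambda-\mu)T_{\lambda+\mu}(b)$ 6. $g_\lambda(a_\mu b,\partial)=g_\lambda(a,-\lambda-\mu)g_{\lambda+\mu}(b,\partial)$ 7. $P(\mu,\lambda+\partial)D_\lambda(a)=D_{\lambda+\mu}(D_\lambda(a))+h_\lambda(a,-\lambda-\mu)Q_0(\lambda+\mu,\partial)-a_\lambda(Q_0(\mu,\partial))$ 8. $P(\mu,\lambda+\partial)h_\lambda(a,\partial)=h_\lambda(a,-\lambda-\mu)P(\lambda+\mu,\partial)+h_{\lambda+\mu}(D_\lambda(a),\partial)$ 9. $T_\lambda(D_\mu(a))+h_\mu(a,\lambda+\partial)Q_0(\lambda,\partial)=D_{\lambda+\mu}(T_\lambda(a))+g_\lambda(a,-\lambda-\mu)Q_0(\lambda+\mu,\partial)$ 10. $g_\lambda(D_\mu(a),\partial)+h_\mu(a,\lambda+\partial)P(\lambda,\partial)=h_{\lambda+\mu}(T_\lambda(a),\partial)+g_\lambda(a,-\lambda-\mu)P(\lambda+\mu,\partial)$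 11. $T_\lambda(T_\mu(a))+g_\mu(a,\lambda+\partial)Q_0(\lambda,\partial)=Q_0(\lambda,\partial)_{\lambda+\mu}a+P(\lambda,-\lambda-\mu)T_{\lambda+\mu}(a)$ 12. $g_\lambda(T_\mu(a),\partial)+g_\mu(a,\lambda+\partial)P(\lambda,\partial)=P(\lambda,-\lambda-\mu)g_{\lambda+\mu}(a,\partial)$ 13. $T_\lambda(Q_0(\mu,\partial))+P(\mu,\lambda+\partial)Q_0(\lambda,\partial)=D_{\lambda+\mu}(Q_0(\lambda,\partial))+P(\lambda,-\lambda-\mu)Q_0(\lambda+\mu,\partial)$ 14. $g_\lambda(Q_0(\mu,\partial),\partial)+P(\mu,\lambda+\partial)P(\lambda,\partial)=h_{\lambda+\mu}(Q_0(\lambda,\partial),\partial)+P(\lambda,-\lambda-\mu)P(\lambda+\mu,\partial)$ *)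

theory Defs
  imports
    "HOL-Analysis.Product_Vector"
    "HOL-Computational_Algebra.Polynomial"
begin

text \<open>
  \<open>\<complex>[\<partial>]\<close> is the ring \<^typ>\<open>complex poly\<close> and a \<open>\<complex>[\<partial>]\<close>-module is a scalar multiplication
  \<open>s\<close> satisfying the locale \<^locale>\<open>module\<close>. For a module \<open>M\<close> with elements of type
  \<open>'m\<close>, \<open>M[\<lambda>]\<close> is the type \<open>'m poly\<close>; in particular \<open>\<complex>[\<lambda>,\<partial>] = (\<complex>[\<partial>])[\<lambda>]\<close> is
  \<^typ>\<open>complex poly poly\<close>, the outer variable being \<open>\<lambda>\<close>, and \<open>\<complex>[\<partial>]\<close> is a module over itself
  by \<open>(*)\<close>. Maps are extended coefficientwise by \<^const>\<open>map_poly\<close>.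
  In \<open>M[\<lambda>,\<mu>]\<close>, that is \<open>'m poly poly\<close>, the outer variable is \<open>\<mu>\<close> and the inner one \<open>\<lambda>\<close>.
\<close>

definition cscale :: "(complex poly \<Rightarrow> 'm \<Rightarrow> 'm) \<Rightarrow> complex \<Rightarrow> 'm \<Rightarrow> 'm" where
  "cscale s c = s [:c:]"

definition del :: "(complex poly \<Rightarrow> 'm \<Rightarrow> 'm) \<Rightarrow> 'm \<Rightarrow> 'm" where
  "del s = s [:0, 1:]"

text \<open>
  \<open>A = \<complex>[\<partial>]V\<close> is free over the \<open>\<complex>\<close>-subspace \<open>V\<close>: the canonical map \<open>\<complex>[\<partial>] \<otimes> V \<rightarrow> A\<close>,
  \<open>p \<otimes> v \<mapsto> p v\<close>, is an isomorphism. Here \<open>\<complex>[\<partial>] \<otimes> V\<close> is \<open>V[\<partial>]\<close>, with \<open>\<partial>\<^sup>i \<otimes> v\<close> being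
  \<open>v \<partial>\<^sup>i\<close>.
\<close>

definition free_over :: "(complex poly \<Rightarrow> 'a::ab_group_add \<Rightarrow> 'a) \<Rightarrow> 'a set \<Rightarrow> bool" where
  "free_over s V \<longleftrightarrow>
     module.subspace (cscale s) V \<and>
     bij_betw (\<lambda>q. \<Sum>i\<le>degree q. (del s ^^ i) (coeff q i)) {q. \<forall>i. coeff q i \<in> V} UNIV"


definition c_linear ::
  "(complex poly \<Rightarrow> 'u::ab_group_add \<Rightarrow> 'u) \<Rightarrow> (complex poly \<Rightarrow> 'v::ab_group_add \<Rightarrow> 'v) \<Rightarrow>
   ('u \<Rightarrow> 'v poly) \<Rightarrow> bool" where
  "c_linear sU sV = Vector_Spaces.linear (cscale sU) (\<lambda>c. map_poly (cscale sV c))"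

definition left_conformal_linear ::
  "(complex poly \<Rightarrow> 'u::ab_group_add \<Rightarrow> 'u) \<Rightarrow> (complex poly \<Rightarrow> 'v::ab_group_add \<Rightarrow> 'v) \<Rightarrow>
   ('u \<Rightarrow> 'v poly) \<Rightarrow> bool" where
  "left_conformal_linear sU sV f \<longleftrightarrow>
     c_linear sU sV f \<and> (\<forall>u. f (del sU u) = - pCons 0 (f u))"

definition conformal_linear ::
  "(complex poly \<Rightarrow> 'u::ab_group_add \<Rightarrow> 'u) \<Rightarrow> (complex poly \<Rightarrow> 'v::ab_group_add \<Rightarrow> 'v) \<Rightarrow>
   ('u \<Rightarrow> 'v poly) \<Rightarrow> bool" where
  "conformal_linear sU sV f \<longleftrightarrow>
     c_linear sU sV f \<and> (\<forall>u. f (del sU u) = map_poly (del sV) (f u) + pCons 0 (f u))"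

definition conformal_bilinear ::
  "(complex poly \<Rightarrow> 'u::ab_group_add \<Rightarrow> 'u) \<Rightarrow> (complex poly \<Rightarrow> 'v::ab_group_add \<Rightarrow> 'v) \<Rightarrow>
   (complex poly \<Rightarrow> 'w::ab_group_add \<Rightarrow> 'w) \<Rightarrow> ('u \<Rightarrow> 'v \<Rightarrow> 'w poly) \<Rightarrow> bool" where
  "conformal_bilinear sU sV sW f \<longleftrightarrow>
     (\<forall>v. left_conformal_linear sU sW (\<lambda>u. f u v)) \<and> (\<forall>u. conformal_linear sV sW (f u))"


text \<open>
  The substitution \<open>\<nu> := \<lambda> + \<mu>\<close> from \<open>M[\<lambda>,\<nu>]\<close> to \<open>M[\<lambda>,\<mu>]\<close>. In the argument the outer variable
  is \<open>\<lambda>\<close> and the inner one \<open>\<nu>\<close>; in the result \<open>\<mu>\<close> is the outer and \<open>\<lambda>\<close> the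
  inner variable, so that multiplication by \<open>\<lambda>\<close> is \<open>map_poly (pCons 0)\<close>.
\<close>

definition subst_sum :: "'m::ab_group_add poly poly \<Rightarrow> 'm poly poly" where
  "subst_sum X =
     (\<Sum>i\<le>degree X. \<Sum>j\<le>degree (coeff X i).
        (map_poly (pCons 0) ^^ i)
          (((\<lambda>F. map_poly (pCons 0) F + pCons 0 F) ^^ j) [:[:coeff (coeff X i) j:]:]))"

text \<open>For \<open>X = p(\<lambda>)\<close> in \<open>U[\<lambda>]\<close> and \<open>f\<^sub>\<lambda> : U \<rightarrow> W[\<lambda>]\<close>, the element \<open>f\<^bsub>\<lambda>+\<mu>\<^esub>(p(\<lambda>))\<close>.\<close>

definition app_sum :: "('u::zero \<Rightarrow> 'w::ab_group_add poly) \<Rightarrow> 'u poly \<Rightarrow> 'w poly poly" where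
  "app_sum f X = subst_sum (map_poly f X)"

text \<open>\<open>p(T) F\<close> for a polynomial \<open>p\<close> and an operator \<open>T\<close> on \<open>M[\<lambda>]\<close>.\<close>

definition poly_op ::
  "(complex poly \<Rightarrow> 'm::ab_group_add \<Rightarrow> 'm) \<Rightarrow> ('m poly \<Rightarrow> 'm poly) \<Rightarrow>
   complex poly \<Rightarrow> 'm poly \<Rightarrow> 'm poly" where
  "poly_op s T p F = (\<Sum>i\<le>degree p. map_poly (cscale s (coeff p i)) ((T ^^ i) F))"

text \<open>For \<open>p(\<lambda>,\<partial>) \<in> \<complex>[\<lambda>,\<partial>]\<close> and \<open>F(\<lambda>) \<in> M[\<lambda>]\<close>, the element \<open>p(\<mu>, \<lambda> + \<partial>) F(\<lambda>)\<close>.\<close>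

definition mult_shift ::
  "(complex poly \<Rightarrow> 'm::ab_group_add \<Rightarrow> 'm) \<Rightarrow> complex poly poly \<Rightarrow> 'm poly \<Rightarrow> 'm poly poly" where
  "mult_shift s p F =
     map_poly (\<lambda>c. poly_op s (\<lambda>G. pCons 0 G + map_poly (del s) G) c F) p"

text \<open>
  For \<open>p(\<lambda>,\<partial>) \<in> \<complex>[\<lambda>,\<partial>]\<close> and \<open>F(\<lambda>) \<in> M[\<lambda>]\<close>, the element
  \<open>p(\<lambda>, -\<lambda>-\<mu>) F(\<lambda> + \<mu>)\<close>, obtained from \<open>p(\<lambda>, -\<nu>) F(\<nu>)\<close> by \<open>\<nu> := \<lambda> + \<mu>\<close>.
\<close>

definition mult_neg_sum ::
  "(complex poly \<Rightarrow> 'm::ab_group_add \<Rightarrow> 'm) \<Rightarrow> complex poly poly \<Rightarrow> 'm poly \<Rightarrow> 'm poly poly" where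
  "mult_neg_sum s p F =
     subst_sum (map_poly (\<lambda>c. poly_op s (\<lambda>G. - pCons 0 G) c F) p)"


locale assoc_conformal_algebra = module s
  for s :: "complex poly \<Rightarrow> 'a::ab_group_add \<Rightarrow> 'a" +
  fixes lprod :: "'a \<Rightarrow> 'a \<Rightarrow> 'a poly"
  assumes bilinear: "conformal_bilinear s s s lprod"
    and assoc: "map_poly (lprod a) (lprod b c) = app_sum (\<lambda>d. lprod d c) (lprod a b)"


type_synonym ('a, 'q) extending_datum =
  "('a \<Rightarrow> 'q \<Rightarrow> 'a poly) \<times> ('a \<Rightarrow> 'q \<Rightarrow> 'q poly) \<times>
   ('q \<Rightarrow> 'a \<Rightarrow> 'q poly) \<times> ('q \<Rightarrow> 'a \<Rightarrow> 'a poly) \<times>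
   ('q \<Rightarrow> 'q \<Rightarrow> 'a poly) \<times> ('q \<Rightarrow> 'q \<Rightarrow> 'q poly)"

text \<open>The identification \<open>A[\<lambda>] \<times> Q[\<lambda>] \<cong> (A \<times> Q)[\<lambda>]\<close>.\<close>

definition pair_poly ::
  "'a::ab_group_add poly \<Rightarrow> 'q::ab_group_add poly \<Rightarrow> ('a \<times> 'q) poly" where
  "pair_poly F G = map_poly (\<lambda>a. (a, 0)) F + map_poly (\<lambda>y. (0, y)) G"

text \<open>
  The components of an extending datum are listed in the order
  \<open>\<leftharpoonup>, \<rightharpoonup>, \<lhd>, \<rhd>, f, \<circ>\<close>.
\<close>

fun extended_lprod ::
  "('a::ab_group_add \<Rightarrow> 'a \<Rightarrow> 'a poly) \<Rightarrow> ('a, 'q::ab_group_add) extending_datum \<Rightarrow>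
   'a \<times> 'q \<Rightarrow> 'a \<times> 'q \<Rightarrow> ('a \<times> 'q) poly" where
  "extended_lprod lprod (lh, rh, lt, rt, f, circ) (a, y) (b, z) =
     pair_poly (lprod a b + lh a z + rt y b + f y z) (rh a z + lt y b + circ y z)"

fun is_extending_datum ::
  "(complex poly \<Rightarrow> 'a::ab_group_add \<Rightarrow> 'a) \<Rightarrow> (complex poly \<Rightarrow> 'q::ab_group_add \<Rightarrow> 'q) \<Rightarrow>
   ('a, 'q) extending_datum \<Rightarrow> bool" where
  "is_extending_datum sA sQ (lh, rh, lt, rt, f, circ) \<longleftrightarrow>
     conformal_bilinear sA sQ sA lh \<and> conformal_bilinear sA sQ sQ rh \<and>
     conformal_bilinear sQ sA sQ lt \<and> conformal_bilinear sQ sA sA rt \<and>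
     conformal_bilinear sQ sQ sA f \<and> conformal_bilinear sQ sQ sQ circ"

definition TC ::
  "(complex poly \<Rightarrow> 'a::ab_group_add \<Rightarrow> 'a) \<Rightarrow> ('a \<Rightarrow> 'a \<Rightarrow> 'a poly) \<Rightarrow>
   (complex poly \<Rightarrow> 'q::ab_group_add \<Rightarrow> 'q) \<Rightarrow> ('a, 'q) extending_datum set" where
  "TC sA lprod sQ =
     {\<Omega>. is_extending_datum sA sQ \<Omega> \<and>
         assoc_conformal_algebra (module_prod.scale sA sQ) (extended_lprod lprod \<Omega>)}"


locale flag_datum =
  fixes s :: "complex poly \<Rightarrow> 'a::ab_group_add \<Rightarrow> 'a"
    and lprod :: "'a \<Rightarrow> 'a \<Rightarrow> 'a poly"
    and V :: "'a set"
    and h :: "'a \<Rightarrow> complex poly poly"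
    and D :: "'a \<Rightarrow> 'a poly"
    and g :: "'a \<Rightarrow> complex poly poly"
    and T :: "'a \<Rightarrow> 'a poly"
    and Q0 :: "'a poly"
    and P :: "complex poly poly"
  assumes h: "left_conformal_linear s (*) h"
    and D: "left_conformal_linear s s D"
    and g: "conformal_linear s (*) g"
    and T: "conformal_linear s s T"
    and F1: "\<lbrakk>a \<in> V; b \<in> V\<rbrakk> \<Longrightarrow>
      app_sum D (lprod a b) = map_poly (lprod a) (D b) + mult_shift s (h b) (D a)"
    and F2: "\<lbrakk>a \<in> V; b \<in> V\<rbrakk> \<Longrightarrow>
      mult_shift (*) (h b) (h a) = app_sum h (lprod a b)"
    and F3: "\<lbrakk>a \<in> V; b \<in> V\<rbrakk> \<Longrightarrow>
      map_poly (lprod a) (T b) + mult_shift s (g b) (D a) =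
      app_sum (\<lambda>d. lprod d b) (D a) + mult_neg_sum s (h a) (T b)"
    and F4: "\<lbrakk>a \<in> V; b \<in> V\<rbrakk> \<Longrightarrow>
      mult_shift (*) (g b) (h a) = mult_neg_sum (*) (h a) (g b)"
    and F5: "\<lbrakk>a \<in> V; b \<in> V\<rbrakk> \<Longrightarrow>
      map_poly T (lprod a b) = app_sum (\<lambda>d. lprod d b) (T a) + mult_neg_sum s (g a) (T b)"
    and F6: "\<lbrakk>a \<in> V; b \<in> V\<rbrakk> \<Longrightarrow>
      map_poly g (lprod a b) = mult_neg_sum (*) (g a) (g b)"
    and F7: "a \<in> V \<Longrightarrow>
      mult_shift s P (D a) =
      app_sum D (D a) + mult_neg_sum s (h a) Q0 - map_poly (lprod a) Q0"
    and F8: "a \<in> V \<Longrightarrow>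
      mult_shift (*) P (h a) = mult_neg_sum (*) (h a) P + app_sum h (D a)"
    and F9: "a \<in> V \<Longrightarrow>
      map_poly T (D a) + mult_shift s (h a) Q0 =
      app_sum D (T a) + mult_neg_sum s (g a) Q0"
    and F10: "a \<in> V \<Longrightarrow>
      map_poly g (D a) + mult_shift (*) (h a) P =
      app_sum h (T a) + mult_neg_sum (*) (g a) P"
    and F11: "a \<in> V \<Longrightarrow>
      map_poly T (T a) + mult_shift s (g a) Q0 =
      app_sum (\<lambda>d. lprod d a) Q0 + mult_neg_sum s P (T a)"
    and F12: "a \<in> V \<Longrightarrow>
      map_poly g (T a) + mult_shift (*) (g a) P = mult_neg_sum (*) P (g a)"
    and F13:
      "map_poly T Q0 + mult_shift s P Q0 = app_sum D Q0 + mult_neg_sum s P Q0"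
    and F14:
      "map_poly g Q0 + mult_shift (*) P P = app_sum h Q0 + mult_neg_sum (*) P P"

definition FAC ::
  "(complex poly \<Rightarrow> 'a::ab_group_add \<Rightarrow> 'a) \<Rightarrow> ('a \<Rightarrow> 'a \<Rightarrow> 'a poly) \<Rightarrow> 'a set \<Rightarrow>
   (('a \<Rightarrow> complex poly poly) \<times> ('a \<Rightarrow> 'a poly) \<times> ('a \<Rightarrow> complex poly poly) \<times>
    ('a \<Rightarrow> 'a poly) \<times> 'a poly \<times> complex poly poly) set" where
  "FAC s lprod V = {(h, D, g, T, Q0, P). flag_datum s lprod V h D g T Q0 P}"

end

theory Submission
  imports Defs
begin

text \<open>
  Conformal linearity of \<open>u \<mapsto> f\<^sub>\<lambda> u\<close> says that \<open>f\<close> is a homomorphism of \<open>\<complex>[\<partial>]\<close>-modules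
  when \<open>\<partial>\<close> acts on the target \<open>W[\<lambda>]\<close> by \<open>-\<lambda>\<close> (left) or by \<open>\<lambda> + \<partial>\<close> (right).
  As these two actions commute, a conformal bilinear map with \<open>Q = \<complex>[\<partial>]x\<close> in one of its arguments
  is the same as its restriction to \<open>x\<close>, so the six maps of an extending datum
  correspond to \<open>D\<close>, \<open>h\<close>, \<open>g\<close>, \<open>T\<close>, \<open>Q\<^sub>0\<close>, \<open>P\<close>. The associativity condition is stable under
  \<open>\<complex>[\<partial>]\<close>-combinations in each of its three arguments, so it suffices to check it on the generators
  \<open>V \<union> {x}\<close> of \<open>A \<times> Q\<close>. Among the eight kinds of triples of generators, the one from \<open>V\<close> only is
  associativity of \<open>A\<close>; the \<open>A\<close>- and \<open>Q\<close>-components of the other seven are the fourteen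
  conditions of a flag datum.
\<close>

subsection \<open>Coefficientwise extensions and Horner sums\<close>

lemma additive_coeff_map_poly:
  "additive f \<Longrightarrow> coeff (map_poly f p) n = f (coeff p n)"
  by (simp add: coeff_map_poly additive.zero)

lemma additive_map_poly: "additive f \<Longrightarrow> additive (map_poly f)"
  by (rule additive.intro, rule poly_eqI) (simp add: additive_coeff_map_poly additive.add)

lemma additive_pCons_0: "additive (pCons 0)"
  by (rule additive.intro) simp

lemma additive_pCons_const: "additive (\<lambda>m. pCons m 0)"
  by (rule additive.intro) simp

lemma additive_compose: "additive f \<Longrightarrow> additive g \<Longrightarrow> additive (\<lambda>x. f (g x))"
  by (simp add: additive_def)

lemma additive_plus:
  "additive f \<Longrightarrow> additive g \<Longrightarrow> additive (\<lambda>x. f x + g x)"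
  by (simp add: additive_def algebra_simps)

lemma additive_uminus: "additive f \<Longrightarrow> additive (\<lambda>x. - f x)"
  by (simp add: additive_def algebra_simps)

lemma additive_id: "additive (\<lambda>x. x)"
  by (simp add: additive_def)

lemma additive_funpow:
  fixes T :: "'a::ab_group_add \<Rightarrow> 'a"
  shows "additive T \<Longrightarrow> additive (T ^^ n)"
  by (induction n) (simp_all add: additive_def)

lemmas additive_intros =
  additive_map_poly additive_pCons_0 additive_pCons_const additive_plus
  additive_uminus additive_id additive_funpow

lemma map_poly_pCons_additive:
  "additive f \<Longrightarrow> map_poly f (pCons a p) = pCons (f a) (map_poly f p)"
  by (simp add: map_poly_pCons additive.zero)

lemma map_poly_map_poly_additive:
  "additive f \<Longrightarrow> additive g \<Longrightarrow> map_poly f (map_poly g p) = map_poly (\<lambda>x. f (g x)) p"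
  by (rule poly_eqI) (simp add: additive_coeff_map_poly additive_compose)

lemma map_poly_plus_fun:
  "additive f \<Longrightarrow> additive g \<Longrightarrow>
    map_poly (\<lambda>x. f x + g x) p = map_poly f p + map_poly g p"
  by (rule poly_eqI) (simp add: additive_coeff_map_poly additive_plus)

lemma map_poly_uminus_fun:
  "additive f \<Longrightarrow> map_poly (\<lambda>x. - f x) p = - map_poly f p"
  by (rule poly_eqI) (simp add: additive_coeff_map_poly additive_uminus)

text \<open>The value of \<open>q\<close> at the operator \<open>T\<close>, with coefficients sent
  into the target by \<open>e\<close>. Both levels of the sum in \<open>subst_sum\<close> and the
  sum in \<open>poly_op\<close> can be brought to this shape, so all share the recursion
  \<open>horner_pCons\<close>.\<close>

definition horner :: "('n \<Rightarrow> 'n) \<Rightarrow> ('m::zero \<Rightarrow> 'n::comm_monoid_add) \<Rightarrow> 'm poly \<Rightarrow> 'n" where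
  "horner T e q = (\<Sum>i\<le>degree q. (T ^^ i) (e (coeff q i)))"

locale horner_ops =
  fixes T :: "'n::ab_group_add \<Rightarrow> 'n" and e :: "'m::ab_group_add \<Rightarrow> 'n"
  assumes T: "additive T" and e: "additive e"
begin

text \<open>Coefficients above the degree contribute zero. A free upper bound lets sums over
  polynomials of different degrees be compared.\<close>

lemma horner_bound:
  assumes "degree q \<le> n"
  shows "horner T e q = (\<Sum>i\<le>n. (T ^^ i) (e (coeff q i)))"
  unfolding horner_def using assms
  by (intro sum.mono_neutral_left)
    (auto simp: coeff_eq_0 additive.zero[OF e] additive.zero[OF additive_funpow[OF T]])

lemma horner_0 [simp]: "horner T e 0 = 0"
  by (simp add: horner_def additive.zero[OF e])

lemma horner_pCons: "horner T e (pCons a q) = e a + T (horner T e q)"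
proof -
  have "horner T e (pCons a q) = (\<Sum>i\<le>Suc (degree q). (T ^^ i) (e (coeff (pCons a q) i)))"
    by (rule horner_bound) (rule degree_pCons_le)
  also have "\<dots> = e a + (\<Sum>i\<le>degree q. T ((T ^^ i) (e (coeff q i))))"
    by (subst sum.atMost_Suc_shift) simp
  finally show ?thesis
    by (simp add: horner_def additive.sum[OF T])
qed

lemma horner_add: "horner T e (p + q) = horner T e p + horner T e q"
proof -
  define n where "n = max (degree p) (degree q)"
  have "degree p \<le> n" "degree q \<le> n" "degree (p + q) \<le> n"
    by (auto simp: n_def intro: degree_add_le)
  then show ?thesis
    by (simp add: horner_bound[of _ n] additive.add[OF e]
        additive.add[OF additive_funpow[OF T]] sum.distrib)
qed

lemma additive_horner: "additive (horner T e)"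
  by (rule additive.intro) (rule horner_add)

end

text \<open>Induction on \<open>q\<close>: both sides satisfy the same recursion, because
  \<open>\<phi>\<close> intertwines the two operators and, up to \<open>g\<close>, the two
  embeddings of coefficients.\<close>

lemma horner_natural:
  assumes "horner_ops T e" "horner_ops T' e'" "additive \<phi>" "g 0 = 0"
    and "\<And>y. \<phi> (T y) = T' (\<phi> y)" and "\<And>a. \<phi> (e a) = e' (g a)"
  shows "\<phi> (horner T e q) = horner T' e' (map_poly g q)"
proof -
  interpret a: horner_ops T e by fact
  interpret b: horner_ops T' e' by fact
  show ?thesis
    by (induction q)
      (simp_all add: a.horner_pCons b.horner_pCons map_poly_pCons assms(3-)
        additive.zero[OF assms(3)] additive.add[OF assms(3)])
qed

subsection \<open>The substitution \<open>\<nu> := \<lambda> + \<mu>\<close>\<close>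

text \<open>In \<open>M[\<lambda>,\<mu>]\<close> with \<mu> outer this is multiplication by
  \<lambda>, and \<open>mult_sum\<close> is multiplication by \<lambda> + \<mu>. On an argument of
  \<open>subst_sum\<close>, whose inner variable is \<nu>, it is multiplication by \<nu>.\<close>

abbreviation mult_inner :: "'m::ab_group_add poly poly \<Rightarrow> 'm poly poly" where
  "mult_inner \<equiv> map_poly (pCons 0)"

abbreviation mult_sum :: "'m::ab_group_add poly poly \<Rightarrow> 'm poly poly" where
  "mult_sum \<equiv> (\<lambda>F. map_poly (pCons 0) F + pCons 0 F)"

text \<open>The substitution \<nu> := \<lambda> + \<mu> on polynomials in \<nu> alone.\<close>

definition subst_inner :: "'m::ab_group_add poly \<Rightarrow> 'm poly poly" where
  "subst_inner = horner mult_sum (\<lambda>m. [:[:m:]:])"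

text \<open>A power of \<open>mult_inner\<close> is additive and comes out of the inner sum, so the
  double sum becomes two nested Horner sums.\<close>

lemma subst_sum_horner: "subst_sum X = horner mult_inner subst_inner X"
proof -
  have "(mult_inner ^^ i) (\<Sum>j\<in>A. f j) = (\<Sum>j\<in>A. (mult_inner ^^ i) (f j :: 'a poly poly))"
    for i f and A :: "nat set"
    by (rule additive.sum) (intro additive_intros)
  then show ?thesis
    by (simp add: subst_sum_def horner_def subst_inner_def)
qed

lemma horner_ops_subst_inner: "horner_ops mult_sum (\<lambda>m. [:[:m:]:])"
  by (intro horner_ops.intro additive_intros additive_compose[OF additive_pCons_const])

lemma additive_subst_inner: "additive subst_inner"
  unfolding subst_inner_def by (rule horner_ops.additive_horner[OF horner_ops_subst_inner])

lemma horner_ops_subst_sum: "horner_ops mult_inner subst_inner"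
  by (intro horner_ops.intro additive_intros additive_subst_inner)

lemma additive_subst_sum: "additive subst_sum"
  using horner_ops.additive_horner[OF horner_ops_subst_sum]
  by (simp add: subst_sum_horner[abs_def])

text \<open>The outer variable of the argument is \<lambda>. The substitution keeps it, but in the
  result it is the inner variable.\<close>

lemma subst_sum_pCons_0: "subst_sum (pCons 0 X) = mult_inner (subst_sum X)"
  by (simp add: subst_sum_horner horner_ops.horner_pCons[OF horner_ops_subst_sum]
      additive.zero[OF additive_subst_inner])

lemma mult_sum_commute: "mult_sum (mult_inner X) = mult_inner (mult_sum X)"
  by (simp add: additive.add[OF additive_map_poly[OF additive_pCons_0]]
      map_poly_pCons_additive additive_pCons_0)

text \<open>The inner variable \<nu> becomes \<lambda> + \<mu>. For polynomials in \<nu> alone this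
  is one step of the recursion; it passes to the outer sum because multiplications by \<lambda> and
  \<lambda> + \<mu> commute.\<close>

lemma subst_sum_mult_inner: "subst_sum (mult_inner X) = mult_sum (subst_sum X)"
proof -
  have "subst_inner (pCons 0 p) = mult_sum (subst_inner p)" for p :: "'a poly"
    by (simp add: subst_inner_def horner_ops.horner_pCons[OF horner_ops_subst_inner])
  then show ?thesis
    unfolding subst_sum_horner
    by (intro horner_natural[symmetric])
      (auto intro!: horner_ops_subst_sum additive_intros mult_sum_commute)
qed

lemma map_poly_map_poly_pCons_0:
  assumes "additive \<phi>"
  shows "map_poly (map_poly \<phi>) (mult_inner X) = mult_inner (map_poly (map_poly \<phi>) X)"
  using assms
  by (simp add: map_poly_map_poly_additive additive_intros map_poly_pCons_additive additive.zero)

lemma map_poly_map_poly_mult_sum: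
  assumes "additive \<phi>"
  shows "map_poly (map_poly \<phi>) (mult_sum X) = mult_sum (map_poly (map_poly \<phi>) X)"
  using assms
  by (simp add: additive.add[OF additive_map_poly[OF additive_map_poly]]
      map_poly_map_poly_pCons_0 map_poly_pCons_additive additive_map_poly additive.zero)

text \<open>Substitution rearranges variables and leaves coefficients alone:
  \<open>horner_natural\<close> applies to the inner sum and then to the outer one.\<close>

lemma subst_sum_natural:
  assumes "additive \<phi>"
  shows "map_poly (map_poly \<phi>) (subst_sum X) = subst_sum (map_poly (map_poly \<phi>) X)"
proof -
  have "map_poly (map_poly \<phi>) (subst_inner p) = subst_inner (map_poly \<phi> p)" for p
    unfolding subst_inner_def
    by (rule horner_natural)
      (auto intro!: horner_ops_subst_inner additive_intros assms map_poly_map_poly_mult_sum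
        simp: map_poly_pCons_additive additive_map_poly assms additive.zero)
  then show ?thesis
    unfolding subst_sum_horner
    by (intro horner_natural)
      (auto intro!: horner_ops_subst_sum additive_intros assms map_poly_map_poly_pCons_0)
qed

lemma app_sum_add:
  "additive f \<Longrightarrow> app_sum f (X + Y) = app_sum f X + app_sum f Y"
  by (simp add: app_sum_def additive.add[OF additive_map_poly] additive.add[OF additive_subst_sum])

lemma additive_app_sum: "additive f \<Longrightarrow> additive (app_sum f)"
  by (rule additive.intro) (rule app_sum_add)

lemma app_sum_pCons_0:
  "additive f \<Longrightarrow> app_sum f (pCons 0 X) = mult_inner (app_sum f X)"
  by (simp add: app_sum_def map_poly_pCons_additive additive.zero subst_sum_pCons_0)

lemma app_sum_plus_fun:
  "additive f \<Longrightarrow> additive g \<Longrightarrow> app_sum (\<lambda>d. f d + g d) X = app_sum f X + app_sum g X"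
  by (simp add: app_sum_def map_poly_plus_fun additive.add[OF additive_subst_sum])

lemma map_poly_const_0: "map_poly (\<lambda>_. 0) X = 0"
  by (rule poly_eqI) (simp add: coeff_map_poly)

lemma app_sum_const_0: "app_sum (\<lambda>_. 0) X = 0"
  by (simp add: app_sum_def map_poly_const_0 additive.zero[OF additive_subst_sum])

lemma app_sum_map_poly:
  "additive f \<Longrightarrow> additive g \<Longrightarrow> app_sum f (map_poly g X) = app_sum (\<lambda>d. f (g d)) X"
  by (simp add: app_sum_def map_poly_map_poly_additive)

lemma app_sum_natural:
  "additive f \<Longrightarrow> additive \<phi> \<Longrightarrow>
    map_poly (map_poly \<phi>) (app_sum f X) = app_sum (\<lambda>d. map_poly \<phi> (f d)) X"
  by (simp add: app_sum_def subst_sum_natural map_poly_map_poly_additive additive_map_poly)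

subsection \<open>Conformal linear maps as module homomorphisms\<close>

lemma additive_scale: "module s \<Longrightarrow> additive (s p)"
  by (rule additive.intro) (rule module.scale_right_distrib)

lemma additive_cscale: "module s \<Longrightarrow> additive (cscale s c)"
  by (simp add: cscale_def additive_scale)

lemma additive_del: "module s \<Longrightarrow> additive (del s)"
  by (simp add: del_def additive_scale)

text \<open>The induction step that reduces the action of \<complex>[\<partial>] to the actions of
  \<complex> and \<partial>.\<close>

lemma scale_pCons:
  assumes "module s"
  shows "s (pCons c p) m = cscale s c m + del s (s p m)"
proof -
  interpret module s by fact
  have "pCons c p = [:c:] + [:0, 1:] * p" by simp
  then show ?thesis
    by (simp only: scale_left_distrib cscale_def del_def scale_scale)
qed

lemma vector_space_cscale:
  assumes "module s"
  shows "vector_space (cscale s)"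
proof -
  interpret module s by fact
  show ?thesis
    by unfold_locales
      (simp_all add: cscale_def scale_right_distrib mult.commute pCons_one
        flip: scale_left_distrib)
qed

lemma vector_space_map_poly_cscale:
  assumes "module s"
  shows "vector_space (\<lambda>c. map_poly (cscale s c))"
proof -
  interpret vector_space "cscale s" by (rule vector_space_cscale) fact
  have "cscale s c 0 = 0" for c by simp
  then show ?thesis
    by unfold_locales
      (auto intro!: poly_eqI simp: coeff_map_poly scale_right_distrib scale_left_distrib)
qed

lemma c_linear_iff:
  assumes "module sU" "module sV"
  shows "c_linear sU sV f \<longleftrightarrow>
    additive f \<and> (\<forall>c u. f (cscale sU c u) = map_poly (cscale sV c) (f u))"
  using assms
  by (simp add: c_linear_def Vector_Spaces.linear_iff vector_space_cscale
      vector_space_map_poly_cscale additive_def)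

section \<open>Polynomials in a \<complex>-linear operator on \<open>M[\<lambda>]\<close>\<close>

locale c_linear_op = module s
  for s :: "complex poly \<Rightarrow> 'm::ab_group_add \<Rightarrow> 'm" +
  fixes T :: "'m poly \<Rightarrow> 'm poly"
  assumes T: "additive T"
    and T_cscale: "T (map_poly (cscale s c) F) = map_poly (cscale s c) (T F)"
begin

lemma vs: "vector_space (\<lambda>c. map_poly (cscale s c))"
  by (rule vector_space_map_poly_cscale) (rule module_axioms)

lemma funpow_cscale: "(T ^^ n) (map_poly (cscale s c) F) = map_poly (cscale s c) ((T ^^ n) F)"
  by (induction n) (simp_all add: T_cscale)

text \<open>\<open>poly_op\<close> scales after applying a power of \<open>T\<close>,
  \<open>horner\<close> before it; the two agree because \<open>T\<close> commutes with
  scalars.\<close>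

lemma poly_op_horner: "poly_op s T p F = horner T (\<lambda>c. map_poly (cscale s c) F) p"
  by (simp add: poly_op_def horner_def funpow_cscale)

lemma horner_ops: "horner_ops T (\<lambda>c. map_poly (cscale s c) F)"
  using T vector_space.vector_space_assms(2)[OF vs]
  by (simp add: horner_ops_def additive_def)

lemma poly_op_0: "poly_op s T 0 F = 0"
  by (simp add: poly_op_horner horner_ops.horner_0[OF horner_ops])

lemma poly_op_pCons: "poly_op s T (pCons c p) F = map_poly (cscale s c) F + T (poly_op s T p F)"
  by (simp add: poly_op_horner horner_ops.horner_pCons[OF horner_ops])

lemma additive_map_poly_cscale: "additive (map_poly (cscale s c))"
  by (intro additive_map_poly additive_cscale module_axioms)

lemma additive_poly_op: "additive (poly_op s T p)"
proof (induction p)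
  case 0
  then show ?case by (simp add: poly_op_0 additive_def)
next
  case (pCons c p)
  then show ?case
    by (simp add: additive_def poly_op_pCons additive.add[OF T]
        additive.add[OF additive_map_poly_cscale])
qed

lemma poly_op_commute:
  assumes "additive \<phi>" and "\<And>F. \<phi> (T F) = T (\<phi> F)"
    and "\<And>c F. \<phi> (map_poly (cscale s c) F) = map_poly (cscale s c) (\<phi> F)"
  shows "\<phi> (poly_op s T p F) = poly_op s T p (\<phi> F)"
  by (induction p)
    (simp_all add: poly_op_0 poly_op_pCons additive.zero additive.add assms)

lemma poly_op_cscale:
  "poly_op s T p (map_poly (cscale s c) F) = map_poly (cscale s c) (poly_op s T p F)"
  by (rule poly_op_commute[symmetric])
    (simp_all add: additive_map_poly_cscale T_cscale vector_space.vector_space_assms(3)[OF vs]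
      mult.commute)

lemma poly_op_const: "poly_op s T [:c:] F = map_poly (cscale s c) F"
  by (simp add: poly_op_pCons poly_op_0 additive.zero[OF T])

lemma poly_op_X: "poly_op s T [:0, 1:] F = T F"
  using vector_space.vector_space_assms(4)[OF vs]
    module.scale_zero_left[OF module_iff_vector_space[THEN iffD2, OF vs]]
  by (simp add: poly_op_pCons poly_op_0 additive.zero[OF T])

text \<open>This makes \<open>M[\<lambda>]\<close> a \<complex>[\<partial>]-module in which
  \<partial> acts as \<open>T\<close>. For \<open>T\<close> equal to -\<lambda> or \<lambda> +
  \<partial>, the homomorphisms into it are the left conformal and the conformal linear
  maps.\<close>

lemma module_poly_op: "module (poly_op s T)"
proof
  fix p q :: "complex poly" and F G :: "'m poly"
  show "poly_op s T p (F + G) = poly_op s T p F + poly_op s T p G"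
    by (rule additive.add[OF additive_poly_op])
  show add: "poly_op s T (p + q) F = poly_op s T p F + poly_op s T q F" for p q F
    by (simp add: poly_op_horner horner_ops.horner_add[OF horner_ops])
  have zero: "map_poly (cscale s 0) F = 0" for F
    using additive.zero[OF horner_ops.e[OF horner_ops], of F] .
  show "poly_op s T 1 F = F"
    using poly_op_const[of 1 F] vector_space.vector_space_assms(4)[OF vs] by (simp add: pCons_one)
  \<comment> \<open>\<open>pCons c p * q\<close> is \<open>smult c q + pCons 0 (p * q)\<close>, so
    the induction for the product uses this case, and \<open>zero\<close> for the constant term of
    the second summand.\<close>
  have smult: "poly_op s T (smult c q) F = map_poly (cscale s c) (poly_op s T q F)" for c q
    by (induction q)
      (simp_all add: poly_op_0 poly_op_pCons additive.zero[OF additive_map_poly_cscale]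
        additive.add[OF additive_map_poly_cscale] T_cscale
        vector_space.vector_space_assms(3)[OF vs])
  show "poly_op s T p (poly_op s T q F) = poly_op s T (p * q) F"
    by (induction p) (simp_all add: poly_op_0 poly_op_pCons add smult zero)
qed

end

\<comment> \<open>otherwise the operator \<open>\<lambda>G. - pCons 0 G\<close> is rewritten under its binder\<close>
declare minus_pCons [simp del]

lemma map_poly_pCons_fun:
  "additive f \<Longrightarrow> map_poly (\<lambda>d. pCons 0 (f d)) X = map_poly (pCons 0) (map_poly f X)"
  by (simp add: map_poly_map_poly_additive additive_pCons_0)

lemma c_linear_op_shift:
  assumes "module s"
  shows "c_linear_op s (\<lambda>G. pCons 0 G + map_poly (del s) G)"
proof -
  interpret module s by fact
  show ?thesis
  proof (intro c_linear_op.intro c_linear_op_axioms.intro)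
    show "module s" by fact
    show "additive (\<lambda>G. pCons 0 G + map_poly (del s) G)"
      by (intro additive_intros additive_del assms)
    have "del s (cscale s c m) = cscale s c (del s m)" for c m
      by (simp add: del_def cscale_def scale_left_commute)
    then show "pCons 0 (map_poly (cscale s c) F) + map_poly (del s) (map_poly (cscale s c) F) =
        map_poly (cscale s c) (pCons 0 F + map_poly (del s) F)" for c F
      by (simp add: additive.add[OF additive_map_poly] additive_cscale additive_del assms
          map_poly_pCons_additive map_poly_map_poly_additive additive.zero)
  qed
qed

lemma c_linear_op_neg:
  assumes "module s"
  shows "c_linear_op s (\<lambda>G. - pCons 0 G)"
proof -
  interpret module s by fact
  show ?thesis
    by (intro c_linear_op.intro c_linear_op_axioms.intro additive_intros assms)
      (simp add: map_poly_pCons_additive additive.minus[OF additive_map_poly]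
        additive_cscale assms additive.zero)
qed

text \<open>An additive map that respects constants and \<partial> respects all of
  \<complex>[\<partial>], by induction on the polynomial. Conversely, constants and \<partial> are
  the special cases \<open>poly_op_const\<close> and \<open>poly_op_X\<close>.\<close>

lemma c_linear_iff_module_hom:
  assumes "c_linear_op sV T" and U: "module sU"
  shows "c_linear sU sV f \<and> (\<forall>u. f (del sU u) = T (f u)) \<longleftrightarrow> module_hom sU (poly_op sV T) f"
    (is "?L \<longleftrightarrow> ?R")
proof -
  interpret c_linear_op sV T by fact
  interpret U: module sU by fact
  interpret V: module "poly_op sV T" by (rule module_poly_op)
  show ?thesis
  proof
    assume ?L
    then have f: "additive f" "\<And>c u. f (cscale sU c u) = map_poly (cscale sV c) (f u)"
      "\<And>u. f (del sU u) = T (f u)"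
      by (auto simp: c_linear_iff U.module_axioms module_axioms)
    have "f (sU p u) = poly_op sV T p (f u)" for p u
      by (induction p)
        (simp_all add: additive.zero additive.add f scale_pCons[OF U] poly_op_pCons)
    then show ?R
      by unfold_locales (simp_all add: additive.add f)
  next
    assume ?R
    then interpret module_hom sU "poly_op sV T" f .
    show ?L
      by (auto simp: c_linear_iff U.module_axioms module_axioms additive_def add scale
          cscale_def[of sU] del_def poly_op_const poly_op_X)
  qed
qed

lemma left_conformal_linear_iff:
  assumes "module sU" "module sV"
  shows "left_conformal_linear sU sV f \<longleftrightarrow> module_hom sU (poly_op sV (\<lambda>G. - pCons 0 G)) f"
  unfolding left_conformal_linear_def
  by (rule c_linear_iff_module_hom) (auto intro: c_linear_op_neg assms)

lemma conformal_linear_iff: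
  assumes "module sU" "module sV"
  shows "conformal_linear sU sV f \<longleftrightarrow>
    module_hom sU (poly_op sV (\<lambda>G. pCons 0 G + map_poly (del sV) G)) f"
  unfolding conformal_linear_def
  by (subst c_linear_iff_module_hom[symmetric])
    (auto intro: c_linear_op_shift assms simp: add.commute)

lemma module_hom_additive: "module_hom s1 s2 f \<Longrightarrow> additive f"
  by (simp add: additive_def module_hom.add)

lemma additive_left_conformal_linear:
  "module sU \<Longrightarrow> module sV \<Longrightarrow> left_conformal_linear sU sV f \<Longrightarrow> additive f"
  by (simp add: left_conformal_linear_iff module_hom_additive)

lemma additive_conformal_linear:
  "module sU \<Longrightarrow> module sV \<Longrightarrow> conformal_linear sU sV f \<Longrightarrow> additive f"
  by (simp add: conformal_linear_iff module_hom_additive)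

section \<open>Naturality, scaling and composition of conformal linear maps\<close>

lemma poly_op_natural:
  assumes "c_linear_op sM S" "c_linear_op sN T" and \<phi>: "module_hom sM sN \<phi>"
    and "\<And>F. map_poly \<phi> (S F) = T (map_poly \<phi> F)"
  shows "map_poly \<phi> (poly_op sM S p F) = poly_op sN T p (map_poly \<phi> F)"
proof -
  interpret M: c_linear_op sM S by fact
  interpret N: c_linear_op sN T by fact
  interpret \<phi>: module_hom sM sN \<phi> by fact
  have add: "additive \<phi>" by (rule module_hom_additive) fact
  have "map_poly \<phi> (map_poly (cscale sM c) F) = map_poly (cscale sN c) (map_poly \<phi> F)" for c F
    by (simp add: map_poly_map_poly_additive add additive_cscale M.module_axioms N.module_axioms
        cscale_def \<phi>.scale additive_scale)
  then show ?thesis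
    by (induction p)
      (simp_all add: M.poly_op_0 N.poly_op_0 M.poly_op_pCons N.poly_op_pCons assms(4)
        additive.add[OF additive_map_poly[OF add]])
qed

lemma map_poly_neg:
  "additive \<phi> \<Longrightarrow> map_poly \<phi> (- pCons 0 F) = - pCons 0 (map_poly \<phi> F)"
  by (simp add: additive.minus[OF additive_map_poly] map_poly_pCons_additive additive.zero)

lemma map_poly_shift:
  assumes "module_hom sM sN \<phi>"
  shows "map_poly \<phi> (pCons 0 F + map_poly (del sM) F) =
    pCons 0 (map_poly \<phi> F) + map_poly (del sN) (map_poly \<phi> F)"
proof -
  interpret module_hom sM sN \<phi> by fact
  have "additive \<phi>" by (rule module_hom_additive) fact
  then show ?thesis
    by (simp add: additive.add[OF additive_map_poly] map_poly_pCons_additive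
        map_poly_map_poly_additive additive_del m1.module_axioms m2.module_axioms)
      (simp add: del_def scale)
qed

lemma poly_op_neg_natural:
  assumes "module_hom sM sN \<phi>"
  shows "map_poly \<phi> (poly_op sM (\<lambda>G. - pCons 0 G) p F) =
    poly_op sN (\<lambda>G. - pCons 0 G) p (map_poly \<phi> F)"
  using assms
  by (intro poly_op_natural c_linear_op_neg map_poly_neg module_hom_additive)
    (auto dest: module_hom.axioms)

lemma poly_op_shift_natural:
  assumes "module_hom sM sN \<phi>"
  shows "map_poly \<phi> (poly_op sM (\<lambda>G. pCons 0 G + map_poly (del sM) G) p F) =
    poly_op sN (\<lambda>G. pCons 0 G + map_poly (del sN) G) p (map_poly \<phi> F)"
  using assms
  by (intro poly_op_natural c_linear_op_shift map_poly_shift)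
    (auto dest: module_hom.axioms)

lemmas module_poly_op_neg = c_linear_op.module_poly_op[OF c_linear_op_neg]
lemmas module_poly_op_shift = c_linear_op.module_poly_op[OF c_linear_op_shift]

lemma additive_module_coeff: "module s \<Longrightarrow> additive (\<lambda>c. s c m)"
  by (simp add: additive_def module.scale_left_distrib)

text \<open>A module homomorphism applied to coefficients commutes with \<lambda> + \<partial>.
  Taking \<open>\<phi>\<close> to be the isomorphism from \<complex>[\<partial>] to \<open>Q\<close>
  will transport identities between \<complex>[\<partial>] and \<open>Q\<close>.\<close>

lemma mult_shift_natural:
  assumes \<phi>: "module_hom sM sN \<phi>"
  shows "map_poly (map_poly \<phi>) (mult_shift sM p F) = mult_shift sN p (map_poly \<phi> F)"
proof -
  interpret module_hom sM sN \<phi> by fact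
  show ?thesis
    unfolding mult_shift_def
    by (simp add: map_poly_map_poly_additive additive_map_poly module_hom_additive[OF \<phi>]
        additive_module_coeff[OF module_poly_op_shift] m1.module_axioms
        poly_op_shift_natural[OF \<phi>])
qed

lemma mult_neg_sum_natural:
  assumes \<phi>: "module_hom sM sN \<phi>"
  shows "map_poly (map_poly \<phi>) (mult_neg_sum sM p F) = mult_neg_sum sN p (map_poly \<phi> F)"
proof -
  interpret module_hom sM sN \<phi> by fact
  show ?thesis
    unfolding mult_neg_sum_def
    by (simp add: subst_sum_natural map_poly_map_poly_additive additive_map_poly
        module_hom_additive[OF \<phi>]
        additive_module_coeff[OF module_poly_op_neg] m1.module_axioms
        poly_op_neg_natural[OF \<phi>])
qed

text \<open>The origin of the factor p(\<mu>, \<lambda> + \<partial>): conformal linearity turns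
  each coefficient c(\<partial>)v into c(\<lambda> + \<partial>) applied to \<open>F v\<close>,
  while the variable of \<open>p\<close> becomes the outer variable \<mu>.\<close>

lemma map_poly_conformal_linear_scale:
  assumes "module sV" "module sW" "conformal_linear sV sW F"
  shows "map_poly F (map_poly (\<lambda>c. sV c v) p) = mult_shift sW p (F v)"
  using assms
  by (simp add: map_poly_map_poly_additive additive_conformal_linear additive_module_coeff
      mult_shift_def conformal_linear_iff module_hom.scale module_hom_additive)

text \<open>The origin of the factor p(\<lambda>, -\<lambda> - \<mu>): left conformal linearity
  turns c(\<partial>)u into c(-\<nu>) times \<open>F u\<close> in the variable \<nu>, and then \<nu>
  := \<lambda> + \<mu>.\<close>

lemma app_sum_left_conformal_linear_scale:
  assumes "module sU" "module sW" "left_conformal_linear sU sW F"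
  shows "app_sum F (map_poly (\<lambda>c. sU c u) p) = mult_neg_sum sW p (F u)"
  using assms
  by (simp add: app_sum_def map_poly_map_poly_additive additive_module_coeff
      mult_neg_sum_def left_conformal_linear_iff module_hom.scale module_hom_additive)

lemma module_hom_poly_op_neg:
  assumes "module_hom sV sW \<phi>"
  shows "module_hom (poly_op sV (\<lambda>G. - pCons 0 G)) (poly_op sW (\<lambda>G. - pCons 0 G)) (map_poly \<phi>)"
proof -
  interpret module_hom sV sW \<phi> by fact
  interpret a: module "poly_op sV (\<lambda>G. - pCons 0 G)"
    by (rule module_poly_op_neg) (rule m1.module_axioms)
  interpret b: module "poly_op sW (\<lambda>G. - pCons 0 G)"
    by (rule module_poly_op_neg) (rule m2.module_axioms)
  show ?thesis
    by unfold_locales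
      (simp_all add: poly_op_neg_natural[OF assms]
        additive.add[OF additive_map_poly[OF module_hom_additive[OF assms]]])
qed

lemma module_hom_poly_op_shift:
  assumes "module_hom sV sW \<phi>"
  shows "module_hom (poly_op sV (\<lambda>G. pCons 0 G + map_poly (del sV) G))
    (poly_op sW (\<lambda>G. pCons 0 G + map_poly (del sW) G)) (map_poly \<phi>)"
proof -
  interpret module_hom sV sW \<phi> by fact
  interpret a: module "poly_op sV (\<lambda>G. pCons 0 G + map_poly (del sV) G)"
    by (rule module_poly_op_shift) (rule m1.module_axioms)
  interpret b: module "poly_op sW (\<lambda>G. pCons 0 G + map_poly (del sW) G)"
    by (rule module_poly_op_shift) (rule m2.module_axioms)
  show ?thesis
    by unfold_locales
      (simp_all add: poly_op_shift_natural[OF assms]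
        additive.add[OF additive_map_poly[OF module_hom_additive[OF assms]]])
qed

text \<open>With \<partial> acting by -\<lambda> on the targets, this is a composition of three
  module homomorphisms.\<close>

lemma left_conformal_linear_compose:
  assumes "module_hom sU' sU \<psi>" "left_conformal_linear sU sV f" "module_hom sV sW \<phi>"
  shows "left_conformal_linear sU' sW (\<lambda>u. map_poly \<phi> (f (\<psi> u)))"
proof -
  have m: "module sU'" "module sU" "module sV" "module sW"
    using assms(1,3) by (auto dest: module_hom.axioms)
  have "module_hom sU (poly_op sV (\<lambda>G. - pCons 0 G)) f"
    using assms(2) m by (simp add: left_conformal_linear_iff)
  from module_hom_compose[OF module_hom_compose[OF assms(1) this] module_hom_poly_op_neg[OF assms(3)]]
  show ?thesis
    using m by (simp add: left_conformal_linear_iff o_def)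
qed

lemma conformal_linear_compose:
  assumes "module_hom sU' sU \<psi>" "conformal_linear sU sV f" "module_hom sV sW \<phi>"
  shows "conformal_linear sU' sW (\<lambda>u. map_poly \<phi> (f (\<psi> u)))"
proof -
  have m: "module sU'" "module sU" "module sV" "module sW"
    using assms(1,3) by (auto dest: module_hom.axioms)
  have "module_hom sU (poly_op sV (\<lambda>G. pCons 0 G + map_poly (del sV) G)) f"
    using assms(2) m by (simp add: conformal_linear_iff)
  from module_hom_compose[OF module_hom_compose[OF assms(1) this] module_hom_poly_op_shift[OF assms(3)]]
  show ?thesis
    using m by (simp add: conformal_linear_iff o_def)
qed

lemma left_conformal_linear_add:
  assumes "module sU" "module sV" "left_conformal_linear sU sV f" "left_conformal_linear sU sV g"
  shows "left_conformal_linear sU sV (\<lambda>u. f u + g u)"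
  using assms
  by (auto simp: left_conformal_linear_iff module_hom_iff module.scale_right_distrib
      add_ac)

lemma conformal_linear_add:
  assumes "module sU" "module sV" "conformal_linear sU sV f" "conformal_linear sU sV g"
  shows "conformal_linear sU sV (\<lambda>u. f u + g u)"
  using assms
  by (auto simp: conformal_linear_iff module_hom_iff module.scale_right_distrib
      add_ac)

subsection \<open>Associativity on generators\<close>

text \<open>A single triple is isolated so that, with two entries fixed, the admissible third
  entries can be shown to form a submodule.\<close>

definition assoc_at :: "('a \<Rightarrow> 'a \<Rightarrow> 'a::ab_group_add poly) \<Rightarrow> 'a \<Rightarrow> 'a \<Rightarrow> 'a \<Rightarrow> bool" where
  "assoc_at L a b c \<longleftrightarrow> map_poly (L a) (L b c) = app_sum (\<lambda>d. L d c) (L a b)"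

lemma subspaceI_del:
  assumes "module s" and "0 \<in> S" and "\<And>x y. x \<in> S \<Longrightarrow> y \<in> S \<Longrightarrow> x + y \<in> S"
    and "\<And>c x. x \<in> S \<Longrightarrow> cscale s c x \<in> S" and "\<And>x. x \<in> S \<Longrightarrow> del s x \<in> S"
  shows "module.subspace s S"
proof -
  interpret module s by fact
  have "s p x \<in> S" if "x \<in> S" for p x
    by (induction p) (simp_all add: assms that scale_pCons[OF assms(1)])
  then show ?thesis
    by (simp add: subspace_def assms)
qed

locale conformal_product = module s
  for s :: "complex poly \<Rightarrow> 'a::ab_group_add \<Rightarrow> 'a" +
  fixes L :: "'a \<Rightarrow> 'a \<Rightarrow> 'a poly"
  assumes bilinear: "conformal_bilinear s s s L"
begin

lemma
  shows additive_left: "additive (\<lambda>a. L a b)"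
    and additive_right: "additive (L a)"
    and cscale_left: "L (cscale s c a) b = map_poly (cscale s c) (L a b)"
    and cscale_right: "L a (cscale s c b) = map_poly (cscale s c) (L a b)"
    and del_left: "L (del s a) b = - pCons 0 (L a b)"
    and del_right: "L a (del s b) = map_poly (del s) (L a b) + pCons 0 (L a b)"
  using bilinear module_axioms
  by (auto simp: conformal_bilinear_def left_conformal_linear_def conformal_linear_def c_linear_iff)

lemma add_left: "L (a + a') = (\<lambda>b. L a b + L a' b)"
  by (rule ext) (rule additive.add[OF additive_left])

lemma add_right: "L a (b + b') = L a b + L a b'"
  by (rule additive.add[OF additive_right])

lemma zero_left [simp]: "L 0 = (\<lambda>_. 0)"
  by (rule ext) (rule additive.zero[OF additive_left])

lemma zero_right [simp]: "L a 0 = 0"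
  by (rule additive.zero[OF additive_right])

lemma additive_scalars: "additive (cscale s c)" "additive (del s)"
  by (auto intro: additive_cscale additive_del module_axioms)

lemma additive_pCons_left: "additive (\<lambda>d. pCons 0 (L d c))"
  by (rule additive_compose[OF additive_pCons_0 additive_left])

lemma additive_del_left: "additive (\<lambda>d. map_poly (del s) (L d c))"
  by (rule additive_compose[OF additive_map_poly[OF additive_scalars(2)] additive_left])

lemma app_sum_0: "app_sum (\<lambda>d. L d c) 0 = 0"
  by (rule additive.zero[OF additive_app_sum[OF additive_left]])

text \<open>Both sides are \<complex>-linear in \<open>a\<close>, and replacing \<open>a\<close> by
  \<partial>a multiplies both by -\<lambda>.\<close>

lemma subspace_assoc_left: "subspace {a. assoc_at L a b c}"
proof (rule subspaceI_del[OF module_axioms])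
  show "0 \<in> {a. assoc_at L a b c}"
    by (simp add: assoc_at_def map_poly_const_0 app_sum_0)
next
  fix a a' assume "a \<in> {a. assoc_at L a b c}" "a' \<in> {a. assoc_at L a b c}"
  then show "a + a' \<in> {a. assoc_at L a b c}"
    by (simp add: assoc_at_def add_left map_poly_plus_fun additive_right
        app_sum_add[OF additive_left])
next
  fix k a assume a: "a \<in> {a. assoc_at L a b c}"
  have "L (cscale s k a) = (\<lambda>d. map_poly (cscale s k) (L a d))"
    by (rule ext) (rule cscale_left)
  then have "map_poly (L (cscale s k a)) (L b c) = map_poly (map_poly (cscale s k)) (map_poly (L a) (L b c))"
    by (simp add: map_poly_map_poly_additive additive_map_poly additive_scalars additive_right)
  also have "\<dots> = app_sum (\<lambda>d. L d c) (L (cscale s k a) b)"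
    using a by (simp add: assoc_at_def app_sum_natural additive_left additive_scalars
        cscale_left app_sum_map_poly)
  finally show "cscale s k a \<in> {a. assoc_at L a b c}"
    by (simp add: assoc_at_def)
next
  fix a assume a: "a \<in> {a. assoc_at L a b c}"
  have "L (del s a) = (\<lambda>d. - pCons 0 (L a d))"
    by (rule ext) (rule del_left)
  then have "map_poly (L (del s a)) (L b c) = - mult_inner (map_poly (L a) (L b c))"
    by (simp add: map_poly_pCons_fun additive_pCons_0 additive_right
        map_poly_uminus_fun additive_compose)
  also have "\<dots> = app_sum (\<lambda>d. L d c) (L (del s a) b)"
    using a by (simp add: assoc_at_def del_left additive.minus[OF additive_app_sum]
        app_sum_pCons_0 additive_left)
  finally show "del s a \<in> {a. assoc_at L a b c}"
    by (simp add: assoc_at_def)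
qed

text \<open>Replacing \<open>b\<close> by \<partial>b multiplies both sides by -\<mu>.\<close>

lemma subspace_assoc_middle: "subspace {b. assoc_at L a b c}"
proof (rule subspaceI_del[OF module_axioms])
  show "0 \<in> {b. assoc_at L a b c}"
    by (simp add: assoc_at_def app_sum_0)
next
  fix b b' assume "b \<in> {b. assoc_at L a b c}" "b' \<in> {b. assoc_at L a b c}"
  then show "b + b' \<in> {b. assoc_at L a b c}"
    by (simp add: assoc_at_def add_left add_right additive.add[OF additive_map_poly]
        additive_right app_sum_add[OF additive_left])
next
  fix k b assume b: "b \<in> {b. assoc_at L a b c}"
  have "map_poly (L a) (L (cscale s k b) c) = map_poly (map_poly (cscale s k)) (map_poly (L a) (L b c))"
    by (simp add: cscale_left cscale_right map_poly_map_poly_additive additive_map_poly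
        additive_scalars additive_right)
  also have "\<dots> = app_sum (\<lambda>d. L d c) (L a (cscale s k b))"
    using b by (simp add: assoc_at_def app_sum_natural additive_left additive_scalars
        cscale_left cscale_right app_sum_map_poly)
  finally show "cscale s k b \<in> {b. assoc_at L a b c}"
    by (simp add: assoc_at_def)
next
  fix b assume b: "b \<in> {b. assoc_at L a b c}"
  \<comment> \<open>In the inner product, \<partial>b gives the factor \<partial> + \<lambda>. Its
    summand \<partial> acts as -(\<lambda> + \<mu>) in the outer product; adding \<lambda> leaves
    -\<mu>.\<close>
  have "app_sum (\<lambda>d. L d c) (map_poly (del s) (L a b)) = app_sum (\<lambda>d. - pCons 0 (L d c)) (L a b)"
    by (simp add: app_sum_map_poly additive_left additive_scalars del_left)
  also have "\<dots> = - mult_sum (app_sum (\<lambda>d. L d c) (L a b))"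
    unfolding app_sum_def
    by (simp add: map_poly_uminus_fun additive_pCons_left additive_left
        additive.minus[OF additive_subst_sum] subst_sum_mult_inner map_poly_pCons_fun)
  finally have "app_sum (\<lambda>d. L d c) (L a (del s b)) = - pCons 0 (app_sum (\<lambda>d. L d c) (L a b))"
    by (simp add: del_right app_sum_add additive_left app_sum_pCons_0)
  moreover have "map_poly (L a) (L (del s b) c) = - pCons 0 (map_poly (L a) (L b c))"
    by (simp add: del_left map_poly_neg additive_right)
  ultimately show "del s b \<in> {b. assoc_at L a b c}"
    using b by (simp add: assoc_at_def)
qed

text \<open>Replacing \<open>c\<close> by \<partial>c applies \<partial> + \<lambda> + \<mu> to both
  sides.\<close>

lemma subspace_assoc_right: "subspace {c. assoc_at L a b c}"
proof (rule subspaceI_del[OF module_axioms])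
  show "0 \<in> {c. assoc_at L a b c}"
    by (simp add: assoc_at_def app_sum_const_0)
next
  fix c c' assume "c \<in> {c. assoc_at L a b c}" "c' \<in> {c. assoc_at L a b c}"
  then show "c + c' \<in> {c. assoc_at L a b c}"
    by (simp add: assoc_at_def add_right additive.add[OF additive_map_poly]
        additive_right app_sum_plus_fun additive_left)
next
  fix k c assume c: "c \<in> {c. assoc_at L a b c}"
  have "map_poly (L a) (L b (cscale s k c)) = map_poly (map_poly (cscale s k)) (map_poly (L a) (L b c))"
    by (simp add: cscale_left cscale_right map_poly_map_poly_additive additive_map_poly
        additive_scalars additive_right)
  also have "\<dots> = app_sum (\<lambda>d. L d (cscale s k c)) (L a b)"
    using c by (simp add: assoc_at_def app_sum_natural additive_left additive_scalars cscale_right)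
  finally show "cscale s k c \<in> {c. assoc_at L a b c}"
    by (simp add: assoc_at_def)
next
  fix c assume c: "c \<in> {c. assoc_at L a b c}"
  let ?Z = "map_poly (L a) (L b c)"
  have "map_poly (L a) (map_poly (del s) (L b c)) =
      map_poly (\<lambda>d. map_poly (del s) (L a d) + pCons 0 (L a d)) (L b c)"
    by (simp add: map_poly_map_poly_additive additive_right additive_scalars del_right)
  also have "\<dots> = map_poly (map_poly (del s)) ?Z + mult_inner ?Z"
    by (simp add: map_poly_plus_fun additive_compose additive_map_poly additive_pCons_0
        additive_scalars additive_right map_poly_map_poly_additive)
  finally have 1: "map_poly (L a) (L b (del s c)) = map_poly (map_poly (del s)) ?Z + mult_sum ?Z"
    by (simp add: del_right additive.add[OF additive_map_poly] additive_right
        map_poly_pCons_additive add_ac)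
  have "app_sum (\<lambda>d. L d (del s c)) (L a b) =
      app_sum (\<lambda>d. map_poly (del s) (L d c)) (L a b) + app_sum (\<lambda>d. pCons 0 (L d c)) (L a b)"
    unfolding del_right
    by (rule app_sum_plus_fun)
      (rule additive_del_left additive_pCons_left)+
  also have "app_sum (\<lambda>d. pCons 0 (L d c)) (L a b) = mult_sum (app_sum (\<lambda>d. L d c) (L a b))"
    by (simp add: app_sum_def subst_sum_mult_inner map_poly_pCons_fun additive_left)
  finally show "del s c \<in> {c. assoc_at L a b c}"
    using c 1 by (simp add: assoc_at_def app_sum_natural additive_left additive_scalars)
qed

text \<open>One entry is freed at a time: with the others fixed, it ranges over a submodule
  containing \<open>G\<close>, hence over everything.\<close>

lemma assoc_on_span:
  assumes G: "span G = UNIV" and gen: "\<And>a b c. a \<in> G \<Longrightarrow> b \<in> G \<Longrightarrow> c \<in> G \<Longrightarrow> assoc_at L a b c"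
  shows "assoc_at L a b c"
proof -
  have ind: "P x" if "subspace (Collect P)" "\<And>y. y \<in> G \<Longrightarrow> P y" for P x
    using span_induct[of x G P] that G by simp
  have 1: "assoc_at L a b c" if "b \<in> G" "c \<in> G" for a b c
    by (rule ind[of _ a]) (auto intro: subspace_assoc_left gen that)
  have 2: "assoc_at L a b c" if "c \<in> G" for a b c
    by (rule ind[of _ b]) (auto intro: subspace_assoc_middle 1 that)
  show ?thesis
    by (rule ind[of _ c]) (auto intro: subspace_assoc_right 2)
qed

end

section \<open>Conformal bilinear maps and free modules of rank one\<close>

locale conformal_bilinear_map = U: module sU + V: module sV + W: module sW
  for sU :: "complex poly \<Rightarrow> 'u::ab_group_add \<Rightarrow> 'u"
    and sV :: "complex poly \<Rightarrow> 'v::ab_group_add \<Rightarrow> 'v"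
    and sW :: "complex poly \<Rightarrow> 'w::ab_group_add \<Rightarrow> 'w" +
  fixes F :: "'u \<Rightarrow> 'v \<Rightarrow> 'w poly"
  assumes bilinear: "conformal_bilinear sU sV sW F"
begin

lemma left: "left_conformal_linear sU sW (\<lambda>u. F u v)"
  and right: "conformal_linear sV sW (F u)"
  using bilinear by (auto simp: conformal_bilinear_def)

lemma additive_left: "additive (\<lambda>u. F u v)"
  using additive_left_conformal_linear[OF U.module_axioms W.module_axioms left] .

lemma additive_right: "additive (F u)"
  using additive_conformal_linear[OF V.module_axioms W.module_axioms right] .

lemma zero_left [simp]: "F 0 = (\<lambda>_. 0)"
  by (rule ext) (rule additive.zero[OF additive_left])

lemma zero_right [simp]: "F u 0 = 0"
  by (rule additive.zero[OF additive_right])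

lemma map_poly_scale: "map_poly (F u) (map_poly (\<lambda>c. sV c v) p) = mult_shift sW p (F u v)"
  by (rule map_poly_conformal_linear_scale[OF V.module_axioms W.module_axioms right])

lemma app_sum_scale: "app_sum (\<lambda>u. F u v) (map_poly (\<lambda>c. sU c u) p) = mult_neg_sum sW p (F u v)"
  by (rule app_sum_left_conformal_linear_scale[OF U.module_axioms W.module_axioms left])

lemma app_sum_0 [simp]: "app_sum (\<lambda>u. F u v) 0 = 0"
  by (rule additive.zero[OF additive_app_sum[OF additive_left]])

lemma scale_left: "F (sU p u) v = poly_op sW (\<lambda>G. - pCons 0 G) p (F u v)"
  by (rule module_hom.scale
      [OF left[unfolded left_conformal_linear_iff[OF U.module_axioms W.module_axioms]]])

lemma scale_right:
  "F u (sV p v) = poly_op sW (\<lambda>G. pCons 0 G + map_poly (del sW) G) p (F u v)"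
  by (rule module_hom.scale
      [OF right[unfolded conformal_linear_iff[OF V.module_axioms W.module_axioms]]])

end

lemma module_times: "module ((*) :: complex poly \<Rightarrow> complex poly \<Rightarrow> complex poly)"
  by unfold_locales (simp_all add: algebra_simps)

text \<open>The operators -\<lambda> and \<lambda> + \<partial> commute, and
  \<open>poly_op_commute\<close> used twice extends this to polynomials in them. It allows a map to
  be extended from a generator without losing conformality in the other argument.\<close>

lemma poly_op_shift_neg_commute:
  assumes s: "module s"
  shows "poly_op s (\<lambda>G. pCons 0 G + map_poly (del s) G) p (poly_op s (\<lambda>G. - pCons 0 G) q F) =
    poly_op s (\<lambda>G. - pCons 0 G) q (poly_op s (\<lambda>G. pCons 0 G + map_poly (del s) G) p F)"
proof -
  interpret N: c_linear_op s "\<lambda>G. - pCons 0 G" by (rule c_linear_op_neg) fact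
  interpret S: c_linear_op s "\<lambda>G. pCons 0 G + map_poly (del s) G" by (rule c_linear_op_shift) fact
  have "poly_op s (\<lambda>G. - pCons 0 G) q (pCons 0 F + map_poly (del s) F) =
      pCons 0 (poly_op s (\<lambda>G. - pCons 0 G) q F) +
      map_poly (del s) (poly_op s (\<lambda>G. - pCons 0 G) q F)" for F
    by (rule N.poly_op_commute[symmetric, OF S.T])
      (simp_all only: S.T_cscale map_poly_neg[OF additive_del[OF s]], simp add: minus_pCons)
  then show ?thesis
    by (rule S.poly_op_commute[symmetric, OF N.additive_poly_op _ N.poly_op_cscale])
qed

locale free_rank_one = module sQ
  for sQ :: "complex poly \<Rightarrow> 'q::ab_group_add \<Rightarrow> 'q" +
  fixes x :: 'q
  assumes independent: "\<not> dependent {x}"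
    and generating: "span {x} = UNIV"
begin

text \<open>The isomorphism from \<complex>[\<partial>] to \<open>Q\<close> sending 1 to
  \<open>x\<close>; its inverse \<open>coord\<close> reads off the coefficient of
  \<open>x\<close>.\<close>

definition gen :: "complex poly \<Rightarrow> 'q" where
  "gen c = sQ c x"

lemma bij_gen: "bij gen"
proof (rule bijI)
  show "surj gen"
    using generating by (simp add: span_singleton gen_def[abs_def])
  show "inj gen"
  proof (rule injI)
    fix c d assume "gen c = gen d"
    then have "sQ (c - d) x = 0"
      by (simp add: gen_def scale_left_diff_distrib)
    then have "c - d = 0"
      using independentD[OF independent, of "{x}" "\<lambda>_. c - d" x] by simp
    then show "c = d" by simp
  qed
qed

definition coord :: "'q \<Rightarrow> complex poly" where
  "coord = inv gen"

lemma gen_coord [simp]: "gen (coord y) = y"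
  using bij_gen by (simp add: coord_def bij_is_surj surj_f_inv_f)

lemma coord_gen [simp]: "coord (gen c) = c"
  using bij_gen by (simp add: coord_def bij_is_inj)

lemma gen_1 [simp]: "gen 1 = x"
  by (simp add: gen_def)

lemma coord_x [simp]: "coord x = 1"
  using coord_gen[of 1] by simp

lemma module_hom_gen: "module_hom (*) sQ gen"
proof -
  interpret m: module "(*) :: complex poly \<Rightarrow> _" by (rule module_times)
  show ?thesis
    by unfold_locales (simp_all add: gen_def scale_left_distrib)
qed

lemma module_hom_coord: "module_hom sQ (*) coord"
proof -
  interpret m: module_hom "(*) :: complex poly \<Rightarrow> _" sQ gen by (rule module_hom_gen)
  have "coord (y + z) = coord y + coord z" for y z
    by (metis coord_gen gen_coord m.add)
  moreover have "coord (sQ p y) = p * coord y" for p y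
    by (metis coord_gen gen_coord m.scale)
  ultimately show ?thesis
    by unfold_locales
qed

lemma additive_gen: "additive gen" and additive_coord: "additive coord"
  using module_hom_gen module_hom_coord by (auto dest: module_hom_additive)

lemma map_poly_gen_coord [simp]: "map_poly gen (map_poly coord F) = F"
  by (simp add: map_poly_map_poly_additive additive_gen additive_coord)

lemma map_poly_coord_gen [simp]: "map_poly coord (map_poly gen F) = F"
  by (simp add: map_poly_map_poly_additive additive_gen additive_coord)

text \<open>Turns equations between \<open>Q\<close>-components into polynomial identities.\<close>

lemma map_poly_map_poly_gen_inject:
  "map_poly (map_poly gen) X = map_poly (map_poly gen) Y \<longleftrightarrow> X = Y"
proof -
  have "map_poly (map_poly coord) (map_poly (map_poly gen) X) = X" for X
    by (simp add: map_poly_map_poly_additive[of "map_poly coord"] additive_map_poly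
        additive_gen additive_coord)
  then show ?thesis by metis
qed

text \<open>The extension is forced: c(\<partial>)x must go to c(\<lambda> + \<partial>) applied to
  \<open>\<phi> u\<close>. It stays left conformal in \<open>u\<close> because polynomials in
  \<lambda> + \<partial> commute with polynomials in -\<lambda>.\<close>

lemma ex_bilinear_right:
  assumes "module sU" and W: "module sW" and \<phi>: "left_conformal_linear sU sW \<phi>"
  shows "\<exists>F. conformal_bilinear sU sQ sW F \<and> (\<forall>u. F u x = \<phi> u)"
proof -
  define F where
    "F u q = poly_op sW (\<lambda>G. pCons 0 G + map_poly (del sW) G) (coord q) (\<phi> u)" for u q
  interpret S: module "poly_op sW (\<lambda>G. pCons 0 G + map_poly (del sW) G)"
    by (rule module_poly_op_shift) fact
  interpret coord: module_hom sQ "(*)" coord by (rule module_hom_coord)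
  interpret \<phi>: module_hom sU "poly_op sW (\<lambda>G. - pCons 0 G)" \<phi>
    using assms by (simp add: left_conformal_linear_iff)
  have "F u x = \<phi> u" for u
    by (simp add: F_def)
  moreover have "conformal_bilinear sU sQ sW F"
    unfolding conformal_bilinear_def
      left_conformal_linear_iff[OF \<open>module sU\<close> W] conformal_linear_iff[OF module_axioms W]
  proof (intro conjI allI)
    show "module_hom sU (poly_op sW (\<lambda>G. - pCons 0 G)) (\<lambda>u. F u q)" for q
      by unfold_locales
        (simp_all add: F_def \<phi>.add \<phi>.scale S.scale_right_distrib poly_op_shift_neg_commute[OF W])
    show "module_hom sQ (poly_op sW (\<lambda>G. pCons 0 G + map_poly (del sW) G)) (F u)" for u
      by unfold_locales (simp_all add: F_def coord.add coord.scale S.scale_left_distrib)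
  qed
  ultimately show ?thesis by blast
qed

text \<open>The mirror image: c(\<partial>)x goes to c(-\<lambda>) times
  \<open>\<phi> v\<close>.\<close>

lemma ex_bilinear_left:
  assumes "module sV" and W: "module sW" and \<phi>: "conformal_linear sV sW \<phi>"
  shows "\<exists>F. conformal_bilinear sQ sV sW F \<and> (\<forall>v. F x v = \<phi> v)"
proof -
  define F where "F q v = poly_op sW (\<lambda>G. - pCons 0 G) (coord q) (\<phi> v)" for q v
  interpret N: module "poly_op sW (\<lambda>G. - pCons 0 G)"
    by (rule module_poly_op_neg) fact
  interpret coord: module_hom sQ "(*)" coord by (rule module_hom_coord)
  interpret \<phi>: module_hom sV "poly_op sW (\<lambda>G. pCons 0 G + map_poly (del sW) G)" \<phi>
    using assms by (simp add: conformal_linear_iff)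
  have "F x v = \<phi> v" for v
    by (simp add: F_def)
  moreover have "conformal_bilinear sQ sV sW F"
    unfolding conformal_bilinear_def
      left_conformal_linear_iff[OF module_axioms W] conformal_linear_iff[OF \<open>module sV\<close> W]
  proof (intro conjI allI)
    show "module_hom sV (poly_op sW (\<lambda>G. pCons 0 G + map_poly (del sW) G)) (F q)" for q
      by unfold_locales
        (simp_all add: F_def \<phi>.add \<phi>.scale N.scale_right_distrib poly_op_shift_neg_commute[OF W])
    show "module_hom sQ (poly_op sW (\<lambda>G. - pCons 0 G)) (\<lambda>q. F q v)" for v
      by unfold_locales (simp_all add: F_def coord.add coord.scale N.scale_left_distrib)
  qed
  ultimately show ?thesis by blast
qed

text \<open>Extend from \<open>x\<close> in the first argument by sending c(\<partial>)x to
  c(-\<lambda>) \<open>G\<close>, then in the second by \<open>ex_bilinear_right\<close>.\<close>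

lemma ex_bilinear_both:
  assumes W: "module sW"
  shows "\<exists>F. conformal_bilinear sQ sQ sW F \<and> F x x = G"
proof -
  interpret N: module "poly_op sW (\<lambda>G. - pCons 0 G)"
    by (rule module_poly_op_neg) fact
  interpret coord: module_hom sQ "(*)" coord by (rule module_hom_coord)
  have "left_conformal_linear sQ sW (\<lambda>q. poly_op sW (\<lambda>G. - pCons 0 G) (coord q) G)"
    unfolding left_conformal_linear_iff[OF module_axioms W]
    by unfold_locales (simp_all add: coord.add coord.scale N.scale_left_distrib)
  from ex_bilinear_right[OF module_axioms W this] show ?thesis
    by fastforce
qed

text \<open>Each \<open>q\<close> is a \<complex>[\<partial>]-multiple of \<open>x\<close>, so
  conformality determines the value at \<open>q\<close> from the value at \<open>x\<close>.\<close>

lemma bilinear_right_unique: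
  assumes "module sU" "module sW" "conformal_bilinear sU sQ sW F" "conformal_bilinear sU sQ sW F'"
    and eq: "\<And>u. F u x = F' u x"
  shows "F = F'"
proof (intro ext)
  interpret F: conformal_bilinear_map sU sQ sW F
    by (intro conformal_bilinear_map.intro conformal_bilinear_map_axioms.intro assms module_axioms)
  interpret F': conformal_bilinear_map sU sQ sW F'
    by (intro conformal_bilinear_map.intro conformal_bilinear_map_axioms.intro assms module_axioms)
  fix u q
  have "F u (gen (coord q)) = F' u (gen (coord q))"
    unfolding gen_def by (simp add: F.scale_right F'.scale_right eq)
  then show "F u q = F' u q" by simp
qed

lemma bilinear_left_unique:
  assumes "module sV" "module sW" "conformal_bilinear sQ sV sW F" "conformal_bilinear sQ sV sW F'"
    and eq: "\<And>v. F x v = F' x v"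
  shows "F = F'"
proof (intro ext)
  interpret F: conformal_bilinear_map sQ sV sW F
    by (intro conformal_bilinear_map.intro conformal_bilinear_map_axioms.intro assms module_axioms)
  interpret F': conformal_bilinear_map sQ sV sW F'
    by (intro conformal_bilinear_map.intro conformal_bilinear_map_axioms.intro assms module_axioms)
  fix q v
  have "F (gen (coord q)) v = F' (gen (coord q)) v"
    unfolding gen_def by (simp add: F.scale_left F'.scale_left eq)
  then show "F q v = F' q v" by simp
qed

lemma bilinear_both_unique:
  assumes "module sW" "conformal_bilinear sQ sQ sW F" "conformal_bilinear sQ sQ sW F'"
    and eq: "F x x = F' x x"
  shows "F = F'"
proof (rule bilinear_left_unique[OF module_axioms assms(1-3)])
  interpret F: conformal_bilinear_map sQ sQ sW F
    by (intro conformal_bilinear_map.intro conformal_bilinear_map_axioms.intro assms module_axioms)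
  interpret F': conformal_bilinear_map sQ sQ sW F'
    by (intro conformal_bilinear_map.intro conformal_bilinear_map_axioms.intro assms module_axioms)
  fix v
  have "F x (gen (coord v)) = F' x (gen (coord v))"
    unfolding gen_def by (simp add: F.scale_right F'.scale_right eq)
  then show "F x v = F' x v" by simp
qed

end

subsection \<open>Extending structures\<close>

lemma map_poly_fst_pair_poly [simp]: "map_poly fst (pair_poly F G) = F"
  and map_poly_snd_pair_poly [simp]: "map_poly snd (pair_poly F G) = G"
  by (auto intro!: poly_eqI simp: pair_poly_def coeff_map_poly zero_prod_def)

lemma additive_fst: "additive fst" and additive_snd: "additive snd"
  by (simp_all add: additive_def)

text \<open>Separates associativity of the extended product into an \<open>A\<close>-component and a
  \<open>Q\<close>-component.\<close>

lemma poly_poly_prod_eq_iff: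
  fixes X Y :: "('a::ab_group_add \<times> 'b::ab_group_add) poly poly"
  shows "X = Y \<longleftrightarrow> map_poly (map_poly fst) X = map_poly (map_poly fst) Y \<and>
    map_poly (map_poly snd) X = map_poly (map_poly snd) Y"
  by (auto simp: poly_eq_iff additive_coeff_map_poly additive_map_poly additive_fst additive_snd
      prod_eq_iff)

lemma left_conformal_linear_pre:
  assumes "module_hom sU' sU \<psi>" "module sV" "left_conformal_linear sU sV f"
  shows "left_conformal_linear sU' sV (\<lambda>u. f (\<psi> u))"
  using left_conformal_linear_compose[OF assms(1,3) module.module_hom_ident[OF assms(2)]] by simp

lemma conformal_linear_pre:
  assumes "module_hom sU' sU \<psi>" "module sV" "conformal_linear sU sV f"
  shows "conformal_linear sU' sV (\<lambda>u. f (\<psi> u))"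
  using conformal_linear_compose[OF assms(1,3) module.module_hom_ident[OF assms(2)]] by simp

lemma left_conformal_linear_post:
  assumes "module sU" "left_conformal_linear sU sV f" "module_hom sV sW \<phi>"
  shows "left_conformal_linear sU sW (\<lambda>u. map_poly \<phi> (f u))"
  using left_conformal_linear_compose[OF module.module_hom_ident[OF assms(1)] assms(2,3)] by simp

lemma conformal_linear_post:
  assumes "module sU" "conformal_linear sU sV f" "module_hom sV sW \<phi>"
  shows "conformal_linear sU sW (\<lambda>u. map_poly \<phi> (f u))"
  using conformal_linear_compose[OF module.module_hom_ident[OF assms(1)] assms(2,3)] by simp

locale extension = A: assoc_conformal_algebra sA lprod + Q: free_rank_one sQ x
  for sA :: "complex poly \<Rightarrow> 'a::ab_group_add \<Rightarrow> 'a"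
    and lprod :: "'a \<Rightarrow> 'a \<Rightarrow> 'a poly"
    and sQ :: "complex poly \<Rightarrow> 'q::ab_group_add \<Rightarrow> 'q"
    and x :: 'q +
  fixes V :: "'a set"
    and lh :: "'a \<Rightarrow> 'q \<Rightarrow> 'a poly" and rh :: "'a \<Rightarrow> 'q \<Rightarrow> 'q poly"
    and lt :: "'q \<Rightarrow> 'a \<Rightarrow> 'q poly" and rt :: "'q \<Rightarrow> 'a \<Rightarrow> 'a poly"
    and f :: "'q \<Rightarrow> 'q \<Rightarrow> 'a poly" and circ :: "'q \<Rightarrow> 'q \<Rightarrow> 'q poly"
  assumes span_V: "A.span V = UNIV"
    and datum: "is_extending_datum sA sQ (lh, rh, lt, rt, f, circ)"
begin

sublocale module_prod sA sQ
  by (intro module_prod.intro module_pair.intro A.module_axioms Q.module_axioms)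

sublocale lprod: conformal_bilinear_map sA sA sA lprod
  by unfold_locales (rule A.bilinear)
sublocale lh: conformal_bilinear_map sA sQ sA lh
  using datum by unfold_locales simp
sublocale rh: conformal_bilinear_map sA sQ sQ rh
  using datum by unfold_locales simp
sublocale lt: conformal_bilinear_map sQ sA sQ lt
  using datum by unfold_locales simp
sublocale rt: conformal_bilinear_map sQ sA sA rt
  using datum by unfold_locales simp
sublocale f: conformal_bilinear_map sQ sQ sA f
  using datum by unfold_locales simp
sublocale circ: conformal_bilinear_map sQ sQ sQ circ
  using datum by unfold_locales simp

abbreviation L where
  "L \<equiv> extended_lprod lprod (lh, rh, lt, rt, f, circ)"

lemma L_eq:
  "L e e' = pair_poly
    (lprod (fst e) (fst e') + lh (fst e) (snd e') + rt (snd e) (fst e') + f (snd e) (snd e'))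
    (rh (fst e) (snd e') + lt (snd e) (fst e') + circ (snd e) (snd e'))"
  by (cases e, cases e') simp

text \<open>Every summand is a conformal bilinear map preceded by projections and followed by an
  inclusion of \<open>A\<close> or \<open>Q\<close>, all of which are module homomorphisms.\<close>

lemma bilinear_L: "conformal_bilinear scale scale scale L"
proof -
  have inl: "module_hom sA scale (\<lambda>a. (a, 0))" and inr: "module_hom sQ scale (\<lambda>y. (0, y))"
    by (unfold_locales, simp_all add: scale_def)+
  show ?thesis
    unfolding conformal_bilinear_def L_eq pair_poly_def
    by (intro conjI allI left_conformal_linear_add conformal_linear_add
        left_conformal_linear_post[OF _ _ inl] left_conformal_linear_post[OF _ _ inr]
        conformal_linear_post[OF _ _ inl] conformal_linear_post[OF _ _ inr]
        left_conformal_linear_pre[OF module_hom_fst] left_conformal_linear_pre[OF module_hom_snd]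
        conformal_linear_pre[OF module_hom_fst] conformal_linear_pre[OF module_hom_snd]
        p.module_axioms A.module_axioms Q.module_axioms
        lprod.left lh.left rh.left lt.left rt.left f.left circ.left
        lprod.right lh.right rh.right lt.right rt.right f.right circ.right)
qed

sublocale L: conformal_product scale L
  by unfold_locales (rule bilinear_L)

section \<open>Components of the associativity condition\<close>

lemma map_poly_fst_L:
  "map_poly (map_poly fst) (map_poly (L (a, y)) Z) =
    map_poly (lprod a) (map_poly fst Z) + map_poly (lh a) (map_poly snd Z) +
    map_poly (rt y) (map_poly fst Z) + map_poly (f y) (map_poly snd Z)"
  by (rule poly_eqI)
    (simp add: additive_coeff_map_poly additive_map_poly additive_fst additive_snd
      L.additive_right lprod.additive_right lh.additive_right rt.additive_right f.additive_right
      L_eq del: extended_lprod.simps)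

lemma map_poly_snd_L:
  "map_poly (map_poly snd) (map_poly (L (a, y)) Z) =
    map_poly (rh a) (map_poly snd Z) + map_poly (lt y) (map_poly fst Z) +
    map_poly (circ y) (map_poly snd Z)"
  by (rule poly_eqI)
    (simp add: additive_coeff_map_poly additive_map_poly additive_fst additive_snd
      L.additive_right rh.additive_right lt.additive_right circ.additive_right
      L_eq del: extended_lprod.simps)

lemma app_sum_fst_L:
  "map_poly (map_poly fst) (app_sum (\<lambda>d. L d (c, w)) Z) =
    app_sum (\<lambda>d. lprod d c) (map_poly fst Z) + app_sum (\<lambda>d. lh d w) (map_poly fst Z) +
    app_sum (\<lambda>d. rt d c) (map_poly snd Z) + app_sum (\<lambda>d. f d w) (map_poly snd Z)"
proof -
  have "map_poly (\<lambda>d. map_poly fst (L d (c, w))) Z =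
      map_poly (\<lambda>d. lprod d c) (map_poly fst Z) + map_poly (\<lambda>d. lh d w) (map_poly fst Z) +
      map_poly (\<lambda>d. rt d c) (map_poly snd Z) + map_poly (\<lambda>d. f d w) (map_poly snd Z)"
    by (rule poly_eqI)
      (simp add: additive_coeff_map_poly coeff_map_poly additive_fst additive_snd
        lprod.additive_left lh.additive_left rt.additive_left f.additive_left
        L_eq del: extended_lprod.simps)
  then show ?thesis
    by (simp add: app_sum_natural L.additive_left additive_fst del: extended_lprod.simps)
      (simp add: app_sum_def additive.add[OF additive_subst_sum] del: extended_lprod.simps)
qed

lemma app_sum_snd_L:
  "map_poly (map_poly snd) (app_sum (\<lambda>d. L d (c, w)) Z) =
    app_sum (\<lambda>d. rh d w) (map_poly fst Z) + app_sum (\<lambda>d. lt d c) (map_poly snd Z) +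
    app_sum (\<lambda>d. circ d w) (map_poly snd Z)"
proof -
  have "map_poly (\<lambda>d. map_poly snd (L d (c, w))) Z =
      map_poly (\<lambda>d. rh d w) (map_poly fst Z) + map_poly (\<lambda>d. lt d c) (map_poly snd Z) +
      map_poly (\<lambda>d. circ d w) (map_poly snd Z)"
    by (rule poly_eqI)
      (simp add: additive_coeff_map_poly coeff_map_poly additive_fst additive_snd
        rh.additive_left lt.additive_left circ.additive_left
        L_eq del: extended_lprod.simps)
  then show ?thesis
    by (simp add: app_sum_natural L.additive_left additive_snd del: extended_lprod.simps)
      (simp add: app_sum_def additive.add[OF additive_subst_sum] del: extended_lprod.simps)
qed

text \<open>\<open>F\<close> and \<open>G\<close> are the components of the product of
  \<open>(b, z)\<close> and \<open>(c, w)\<close>, while \<open>F'\<close> and \<open>G'\<close> are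
  those of the product of \<open>e\<close> and \<open>(b, z)\<close>. The two equations are the
  \<open>A\<close>- and the \<open>Q\<close>-component.\<close>

lemma assoc_at_L_iff:
  "assoc_at L e (b, z) (c, w) \<longleftrightarrow>
    (let a = fst e; y = snd e;
       F = lprod b c + lh b w + rt z c + f z w; G = rh b w + lt z c + circ z w;
       F' = lprod a b + lh a z + rt y b + f y z; G' = rh a z + lt y b + circ y z
     in map_poly (lprod a) F + map_poly (lh a) G + map_poly (rt y) F + map_poly (f y) G =
          app_sum (\<lambda>d. lprod d c) F' + app_sum (\<lambda>d. lh d w) F' +
          app_sum (\<lambda>d. rt d c) G' + app_sum (\<lambda>d. f d w) G' \<and>
        map_poly (rh a) G + map_poly (lt y) F + map_poly (circ y) G =
          app_sum (\<lambda>d. rh d w) F' + app_sum (\<lambda>d. lt d c) G' + app_sum (\<lambda>d. circ d w) G')"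
proof (cases e)
  case (Pair a y)
  show ?thesis
    unfolding assoc_at_def poly_poly_prod_eq_iff[of "map_poly _ _"] Pair
      map_poly_fst_L map_poly_snd_L app_sum_fst_L app_sum_snd_L
    by (simp add: Let_def)
qed

text \<open>The elements \<open>a\<close> with \<open>(a, 0)\<close> in the span form a submodule of
  \<open>A\<close> containing \<open>V\<close>, hence all of \<open>A\<close>. For \<open>Q\<close>,
  multiples of \<open>(0, x)\<close> suffice.\<close>

lemma scale_span_UNIV: "p.span ((\<lambda>v. (v, 0)) ` V \<union> {(0, x)}) = UNIV" (is "p.span ?G = _")
proof -
  have "(a, 0) \<in> p.span ?G" for a
  proof -
    have sub: "A.subspace {a. (a, 0) \<in> p.span ?G}"
      unfolding A.subspace_def
    proof (intro conjI ballI allI)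
      show "0 \<in> {a. (a, 0) \<in> p.span ?G}"
        using p.span_zero[of ?G] by (simp add: zero_prod_def)
    next
      fix a b assume "a \<in> {a. (a, 0) \<in> p.span ?G}" "b \<in> {a. (a, 0) \<in> p.span ?G}"
      then have "(a, 0) + (b, 0) \<in> p.span ?G" by (simp only: mem_Collect_eq p.span_add)
      then show "a + b \<in> {a. (a, 0) \<in> p.span ?G}" by simp
    next
      fix k a assume "a \<in> {a. (a, 0) \<in> p.span ?G}"
      then have "scale k (a, 0) \<in> p.span ?G" by (simp only: mem_Collect_eq p.span_scale)
      then show "sA k a \<in> {a. (a, 0) \<in> p.span ?G}" by (simp add: scale_def)
    qed
    show ?thesis
      using A.span_induct[of a V "\<lambda>a. (a, 0) \<in> p.span ?G", OF _ sub] span_V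
      by (auto intro: p.span_base)
  qed
  moreover have "(0, y) \<in> p.span ?G" for y
  proof -
    have "scale (Q.coord y) (0, x) \<in> p.span ?G"
      by (intro p.span_scale p.span_base) simp
    then show ?thesis
      using Q.gen_coord[of y] by (simp add: scale_def Q.gen_def)
  qed
  ultimately have "(a, 0) + (0, y) \<in> p.span ?G" for a y
    by (rule p.span_add)
  then show ?thesis by auto
qed

lemma assoc_conformal_algebra_iff_assoc_at:
  "assoc_conformal_algebra scale L \<longleftrightarrow>
    (\<forall>a\<in>V. \<forall>b\<in>V. assoc_at L (a, 0) (b, 0) (0, x)) \<and>
    (\<forall>a\<in>V. \<forall>b\<in>V. assoc_at L (a, 0) (0, x) (b, 0)) \<and>
    (\<forall>a\<in>V. \<forall>b\<in>V. assoc_at L (0, x) (a, 0) (b, 0)) \<and>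
    (\<forall>a\<in>V. assoc_at L (a, 0) (0, x) (0, x)) \<and>
    (\<forall>a\<in>V. assoc_at L (0, x) (a, 0) (0, x)) \<and>
    (\<forall>a\<in>V. assoc_at L (0, x) (0, x) (a, 0)) \<and>
    assoc_at L (0, x) (0, x) (0, x)" (is "?L \<longleftrightarrow> ?R")
proof
  assume ?L
  then interpret E: assoc_conformal_algebra scale L .
  have "assoc_at L a b c" for a b c
    unfolding assoc_at_def by (rule E.assoc)
  then show ?R by simp
next
  assume R: ?R
  \<comment> \<open>For triples from \<open>A\<close> all terms with an entry in \<open>Q\<close>
    vanish, and associativity of \<open>A\<close> remains.\<close>
  have A: "assoc_at L (a, 0) (b, 0) (c, 0)" for a b c
    by (simp add: assoc_at_L_iff Let_def map_poly_const_0 app_sum_const_0 A.assoc)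
  have "assoc_at L a b c" for a b c
  proof (rule L.assoc_on_span[OF scale_span_UNIV])
    fix a b c
    assume "a \<in> (\<lambda>v. (v, 0)) ` V \<union> {(0, x)}" "b \<in> (\<lambda>v. (v, 0)) ` V \<union> {(0, x)}"
      "c \<in> (\<lambda>v. (v, 0)) ` V \<union> {(0, x)}"
    then show "assoc_at L a b c"
      using R by (elim UnE imageE singletonE) (simp_all add: A)
  qed
  then show ?L
    by (intro assoc_conformal_algebra.intro assoc_conformal_algebra_axioms.intro
        p.module_axioms bilinear_L) (simp only: assoc_at_def)
qed

text \<open>The \<open>Q\<close>-valued maps at \<open>x\<close> are presented as images under
  \<open>gen\<close>, so that the \<open>Q\<close>-components of associativity can be pulled back to
  equations for \<open>h\<close>, \<open>g\<close> and \<open>P\<close>.\<close>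

context
  fixes h g :: "'a \<Rightarrow> complex poly poly" and P :: "complex poly poly"
  assumes rh_x: "\<And>a. rh a x = map_poly Q.gen (h a)"
    and lt_x: "\<And>a. lt x a = map_poly Q.gen (g a)"
    and circ_x: "circ x x = map_poly Q.gen P"
begin

lemma left_conformal_linear_h: "left_conformal_linear sA (*) h"
proof -
  have "h = (\<lambda>a. map_poly Q.coord (rh a x))"
    by (simp add: rh_x)
  then show ?thesis
    using left_conformal_linear_post[OF A.module_axioms rh.left[of x] Q.module_hom_coord] by simp
qed

lemma conformal_linear_g: "conformal_linear sA (*) g"
proof -
  have "g = (\<lambda>a. map_poly Q.coord (lt x a))"
    by (simp add: lt_x)
  then show ?thesis
    using conformal_linear_post[OF A.module_axioms lt.right[of x] Q.module_hom_coord] by simp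
qed

lemma additive_h: "additive h" and additive_g: "additive g"
  using additive_left_conformal_linear[OF A.module_axioms module_times left_conformal_linear_h]
    additive_conformal_linear[OF A.module_axioms module_times conformal_linear_g] .

text \<open>Oriented so that each side of an equation is collected into one image under
  \<open>gen\<close>, where injectivity applies.\<close>

lemma gen_add:
  "map_poly (map_poly Q.gen) X + map_poly (map_poly Q.gen) Y = map_poly (map_poly Q.gen) (X + Y)"
  by (simp add: additive.add[OF additive_map_poly[OF additive_map_poly[OF Q.additive_gen]]])

lemma mult_shift_gen:
  "mult_shift sQ p (map_poly Q.gen F) = map_poly (map_poly Q.gen) (mult_shift (*) p F)"
  by (rule mult_shift_natural[OF Q.module_hom_gen, symmetric])

lemma mult_neg_sum_gen:
  "mult_neg_sum sQ p (map_poly Q.gen F) = map_poly (map_poly Q.gen) (mult_neg_sum (*) p F)"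
  by (rule mult_neg_sum_natural[OF Q.module_hom_gen, symmetric])

lemma app_sum_gen: "app_sum (\<lambda>d. map_poly Q.gen (h d)) X = map_poly (map_poly Q.gen) (app_sum h X)"
  by (simp add: app_sum_natural additive_h Q.additive_gen)

lemma map_poly_lt: "map_poly (lt x) X = map_poly (map_poly Q.gen) (map_poly g X)"
proof -
  have "lt x = (\<lambda>a. map_poly Q.gen (g a))"
    by (rule ext) (rule lt_x)
  then show ?thesis
    by (simp add: map_poly_map_poly_additive additive_map_poly Q.additive_gen additive_g)
qed

text \<open>Right factors of the form p(\<lambda>,\<partial>)x appear as
  \<open>map_poly Q.gen p\<close>, hence the folding of \<open>gen\<close>. Left factors of this
  form are handled by \<open>neg_gen\<close>.\<close>

lemmas shift_gen =
  lh.map_poly_scale[of _ x, folded Q.gen_def[abs_def]]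
  rh.map_poly_scale[of _ x, folded Q.gen_def[abs_def]]
  f.map_poly_scale[of _ x, folded Q.gen_def[abs_def]]
  circ.map_poly_scale[of _ x, folded Q.gen_def[abs_def]]

lemmas neg_gen =
  lt.app_sum_scale[of _ x, folded Q.gen_def[abs_def]]
  rt.app_sum_scale[of _ x, folded Q.gen_def[abs_def]]
  f.app_sum_scale[of _ x, folded Q.gen_def[abs_def]]
  circ.app_sum_scale[of _ x, folded Q.gen_def[abs_def]]

lemmas unfold_simps = assoc_at_L_iff Let_def map_poly_const_0 app_sum_const_0

lemmas component_simps = app_sum_gen map_poly_lt
  shift_gen neg_gen rh_x lt_x circ_x mult_shift_gen mult_neg_sum_gen gen_add
  Q.map_poly_map_poly_gen_inject

text \<open>Each of the seven mixed types of triples gives one equation in \<open>A\<close> and one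
  in \<open>Q\<close>, the latter pulled back along \<open>gen\<close>. Here they are
  \<open>F1\<close> and \<open>F2\<close>: the product of \<open>b\<close> and \<open>x\<close> has
  \<open>Q\<close>-part \<open>h b\<close>, and multiplying it by \<open>a\<close> from the left
  produces the shifted factor.\<close>

lemma assoc_at_AAx:
  "assoc_at L (a, 0) (b, 0) (0, x) \<longleftrightarrow>
    app_sum (\<lambda>a. lh a x) (lprod a b) =
      map_poly (lprod a) (lh b x) + mult_shift sA (h b) (lh a x) \<and>
    mult_shift (*) (h b) (h a) = app_sum h (lprod a b)"
  by (simp add: unfold_simps, auto simp: component_simps)

lemma assoc_at_AxA:
  "assoc_at L (a, 0) (0, x) (b, 0) \<longleftrightarrow>
    map_poly (lprod a) (rt x b) + mult_shift sA (g b) (lh a x) =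
      app_sum (\<lambda>d. lprod d b) (lh a x) + mult_neg_sum sA (h a) (rt x b) \<and>
    mult_shift (*) (g b) (h a) = mult_neg_sum (*) (h a) (g b)"
  by (simp add: unfold_simps, auto simp: component_simps)

lemma assoc_at_xAA:
  "assoc_at L (0, x) (a, 0) (b, 0) \<longleftrightarrow>
    map_poly (rt x) (lprod a b) =
      app_sum (\<lambda>d. lprod d b) (rt x a) + mult_neg_sum sA (g a) (rt x b) \<and>
    map_poly g (lprod a b) = mult_neg_sum (*) (g a) (g b)"
  by (simp add: unfold_simps, auto simp: component_simps)

lemma assoc_at_Axx:
  "assoc_at L (a, 0) (0, x) (0, x) \<longleftrightarrow>
    mult_shift sA P (lh a x) =
      app_sum (\<lambda>a. lh a x) (lh a x) + mult_neg_sum sA (h a) (f x x) -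
      map_poly (lprod a) (f x x) \<and>
    mult_shift (*) P (h a) = mult_neg_sum (*) (h a) P + app_sum h (lh a x)"
  \<comment> \<open>Associativity has the term \<open>map_poly (lprod a) (f x x)\<close> on the
    left; \<open>eq_diff_eq\<close> reconciles this with its subtraction on the right.\<close>
  by (simp add: unfold_simps, auto simp: component_simps eq_diff_eq add.commute)

lemma assoc_at_xAx:
  "assoc_at L (0, x) (a, 0) (0, x) \<longleftrightarrow>
    map_poly (rt x) (lh a x) + mult_shift sA (h a) (f x x) =
      app_sum (\<lambda>a. lh a x) (rt x a) + mult_neg_sum sA (g a) (f x x) \<and>
    map_poly g (lh a x) + mult_shift (*) (h a) P =
      app_sum h (rt x a) + mult_neg_sum (*) (g a) P"
  by (simp add: unfold_simps, auto simp: component_simps add.commute)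

lemma assoc_at_xxA:
  "assoc_at L (0, x) (0, x) (a, 0) \<longleftrightarrow>
    map_poly (rt x) (rt x a) + mult_shift sA (g a) (f x x) =
      app_sum (\<lambda>d. lprod d a) (f x x) + mult_neg_sum sA P (rt x a) \<and>
    map_poly g (rt x a) + mult_shift (*) (g a) P = mult_neg_sum (*) P (g a)"
  by (simp add: unfold_simps, auto simp: component_simps add.commute)

lemma assoc_at_xxx:
  "assoc_at L (0, x) (0, x) (0, x) \<longleftrightarrow>
    map_poly (rt x) (f x x) + mult_shift sA P (f x x) =
      app_sum (\<lambda>a. lh a x) (f x x) + mult_neg_sum sA P (f x x) \<and>
    map_poly g (f x x) + mult_shift (*) P P = app_sum h (f x x) + mult_neg_sum (*) P P"
  by (simp add: unfold_simps, auto simp: component_simps add.commute)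

text \<open>Generators reduce associativity to seven families of triples, whose components are
  \<open>F1\<close> to \<open>F14\<close>. The conformal linearity conditions on the four maps come
  from the bilinearity of the datum.\<close>

lemma assoc_conformal_algebra_iff_flag_datum:
  "assoc_conformal_algebra scale L \<longleftrightarrow>
    flag_datum sA lprod V h (\<lambda>a. lh a x) g (\<lambda>a. rt x a) (f x x) P"
proof
  assume "assoc_conformal_algebra scale L"
  note generators = this[unfolded assoc_conformal_algebra_iff_assoc_at]
  have AAx: "assoc_at L (a, 0) (b, 0) (0, x)" and AxA: "assoc_at L (a, 0) (0, x) (b, 0)"
    and xAA: "assoc_at L (0, x) (a, 0) (b, 0)" if "a \<in> V" "b \<in> V" for a b
    using generators that by simp_all
  have Axx: "assoc_at L (a, 0) (0, x) (0, x)" and xAx: "assoc_at L (0, x) (a, 0) (0, x)"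
    and xxA: "assoc_at L (0, x) (0, x) (a, 0)" if "a \<in> V" for a
    using generators that by simp_all
  have xxx: "assoc_at L (0, x) (0, x) (0, x)"
    using generators by simp
  show "flag_datum sA lprod V h (\<lambda>a. lh a x) g (\<lambda>a. rt x a) (f x x) P"
    by (rule flag_datum.intro[OF left_conformal_linear_h lh.left conformal_linear_g rt.right])
      (fact AAx[unfolded assoc_at_AAx, THEN conjunct1] AAx[unfolded assoc_at_AAx, THEN conjunct2]
        AxA[unfolded assoc_at_AxA, THEN conjunct1] AxA[unfolded assoc_at_AxA, THEN conjunct2]
        xAA[unfolded assoc_at_xAA, THEN conjunct1] xAA[unfolded assoc_at_xAA, THEN conjunct2]
        Axx[unfolded assoc_at_Axx, THEN conjunct1] Axx[unfolded assoc_at_Axx, THEN conjunct2]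
        xAx[unfolded assoc_at_xAx, THEN conjunct1] xAx[unfolded assoc_at_xAx, THEN conjunct2]
        xxA[unfolded assoc_at_xxA, THEN conjunct1] xxA[unfolded assoc_at_xxA, THEN conjunct2]
        xxx[unfolded assoc_at_xxx, THEN conjunct1] xxx[unfolded assoc_at_xxx, THEN conjunct2])+
next
  assume "flag_datum sA lprod V h (\<lambda>a. lh a x) g (\<lambda>a. rt x a) (f x x) P"
  then interpret flag: flag_datum sA lprod V h "\<lambda>a. lh a x" g "\<lambda>a. rt x a" "f x x" P .
  show "assoc_conformal_algebra scale L"
    unfolding assoc_conformal_algebra_iff_assoc_at
      assoc_at_AAx assoc_at_AxA assoc_at_xAA assoc_at_Axx assoc_at_xAx assoc_at_xxA assoc_at_xxx
    by (intro conjI ballI; fact flag.F1 flag.F2 flag.F3 flag.F4 flag.F5 flag.F6 flag.F7 flag.F8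
        flag.F9 flag.F10 flag.F11 flag.F12 flag.F13 flag.F14)
qed

end

end

text \<open>By surjectivity of the canonical map, every element is a finite sum of terms
  \<partial>^i v with v in \<open>V\<close>.\<close>

lemma free_over_span:
  assumes "module s" and "free_over s V"
  shows "module.span s V = UNIV"
proof -
  interpret module s by fact
  have "(del s ^^ i) v \<in> span V" if "v \<in> V" for i v
    by (induction i) (auto simp: del_def intro: span_scale span_base that)
  then have "(\<Sum>i\<le>degree q. (del s ^^ i) (coeff q i)) \<in> span V" if "\<forall>i. coeff q i \<in> V" for q
    using that by (intro span_sum) simp
  moreover have "\<exists>q. (\<forall>i. coeff q i \<in> V) \<and> m = (\<Sum>i\<le>degree q. (del s ^^ i) (coeff q i))" for m
    using assms(2) by (auto simp: free_over_def bij_betw_def image_iff set_eq_iff)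
  ultimately show ?thesis by (metis UNIV_eq_I)
qed

section \<open>The bijection between extending structures and flag data\<close>

theorem proposition5p2:
  fixes sA :: "complex poly \<Rightarrow> 'a::ab_group_add \<Rightarrow> 'a"
    and lprod :: "'a \<Rightarrow> 'a \<Rightarrow> 'a poly"
    and V :: "'a set"
    and sQ :: "complex poly \<Rightarrow> 'q::ab_group_add \<Rightarrow> 'q"
    and x :: 'q
  assumes "assoc_conformal_algebra sA lprod"
    and "free_over sA V"
    and "module sQ"
    and "\<not> module.dependent sQ {x}"
    and "module.span sQ {x} = UNIV"
  shows "\<exists>\<Phi>. bij_betw \<Phi> (TC sA lprod sQ) (FAC sA lprod V)"
proof -
  interpret A: assoc_conformal_algebra sA lprod by fact
  interpret Q: free_rank_one sQ x
    using assms(3-5) by (simp add: free_rank_one_def free_rank_one_axioms_def)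
  note modules = A.module_axioms Q.module_axioms
  \<comment> \<open>Restriction of the six maps to the generator \<open>x\<close>, with values in
    \<open>Q\<close> expressed in coordinates.\<close>
  define \<Phi> :: "('a, 'q) extending_datum \<Rightarrow> _" where
    "\<Phi> = (\<lambda>(lh, rh, lt, rt, f, circ).
      (\<lambda>a. map_poly Q.coord (rh a x), \<lambda>a. lh a x, \<lambda>a. map_poly Q.coord (lt x a), \<lambda>a. rt x a,
       f x x, map_poly Q.coord (circ x x)))"
  \<comment> \<open>Stated for every extending datum because it serves both inclusions:
    \<open>\<Phi>\<close> maps \<open>TC\<close> into \<open>FAC\<close>, and a datum lifted from a
    flag datum lies in \<open>TC\<close>.\<close>
  have iff: "(lh, rh, lt, rt, f, circ) \<in> TC sA lprod sQ \<longleftrightarrow>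
      \<Phi> (lh, rh, lt, rt, f, circ) \<in> FAC sA lprod V"
    if datum: "is_extending_datum sA sQ (lh, rh, lt, rt, f, circ)" for lh rh lt rt f circ
  proof -
    interpret extension sA lprod sQ x V lh rh lt rt f circ
      using free_over_span[OF A.module_axioms assms(2)] datum by unfold_locales auto
    show ?thesis
      using datum assoc_conformal_algebra_iff_flag_datum[of "\<lambda>a. map_poly Q.coord (rh a x)"
          "\<lambda>a. map_poly Q.coord (lt x a)" "map_poly Q.coord (circ x x)"]
      by (simp add: TC_def FAC_def \<Phi>_def)
  qed
  have "bij_betw \<Phi> (TC sA lprod sQ) (FAC sA lprod V)"
    unfolding bij_betw_def
  proof
    show "inj_on \<Phi> (TC sA lprod sQ)"
    proof (rule inj_onI)
      fix \<Omega> \<Omega>' :: "('a, 'q) extending_datum"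
      assume mem: "\<Omega> \<in> TC sA lprod sQ" "\<Omega>' \<in> TC sA lprod sQ" and eq: "\<Phi> \<Omega> = \<Phi> \<Omega>'"
      obtain lh rh lt rt f circ where \<Omega>: "\<Omega> = (lh, rh, lt, rt, f, circ)" by (cases \<Omega>)
      obtain lh' rh' lt' rt' f' circ' where \<Omega>': "\<Omega>' = (lh', rh', lt', rt', f', circ')" by (cases \<Omega>')
      \<comment> \<open>Three entries of \<open>\<Phi>\<close> are stored in coordinates; equality
        of coordinates has to give equality in \<open>Q\<close>.\<close>
      have coord: "map_poly Q.coord X = map_poly Q.coord Y \<Longrightarrow> X = Y" for X Y
        by (metis Q.map_poly_gen_coord)
      have "lh a x = lh' a x" "rh a x = rh' a x" "lt x a = lt' x a" "rt x a = rt' x a"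
        "f x x = f' x x" "circ x x = circ' x x" for a
        using eq by (auto simp: \<Omega> \<Omega>' \<Phi>_def fun_eq_iff intro: coord)
      then have "lh = lh'" "rh = rh'" "lt = lt'" "rt = rt'" "f = f'" "circ = circ'"
        using mem modules unfolding \<Omega> \<Omega>' TC_def
        by (auto intro: Q.bilinear_right_unique Q.bilinear_left_unique Q.bilinear_both_unique)
      then show "\<Omega> = \<Omega>'" by (simp add: \<Omega> \<Omega>')
    qed
    show "\<Phi> ` TC sA lprod sQ = FAC sA lprod V"
    proof (intro equalityI subsetI)
      fix t assume "t \<in> \<Phi> ` TC sA lprod sQ"
      then show "t \<in> FAC sA lprod V"
        using iff by (auto simp: TC_def)
    next
      fix t assume "t \<in> FAC sA lprod V"
      then obtain h D g T Q0 P where t: "t = (h, D, g, T, Q0, P)"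
        and flag: "flag_datum sA lprod V h D g T Q0 P"
        by (auto simp: FAC_def)
      interpret flag_datum sA lprod V h D g T Q0 P by fact
      \<comment> \<open>A preimage is built by extending each entry of the flag datum from
        \<open>x\<close>; \<open>h\<close>, \<open>g\<close> and \<open>P\<close> are first carried
        to \<open>Q\<close> by \<open>gen\<close>.\<close>
      obtain lh where lh: "conformal_bilinear sA sQ sA lh" "\<And>a. lh a x = D a"
        using Q.ex_bilinear_right[OF A.module_axioms A.module_axioms D] by blast
      obtain rh where rh: "conformal_bilinear sA sQ sQ rh" "\<And>a. rh a x = map_poly Q.gen (h a)"
        using Q.ex_bilinear_right[OF modules
            left_conformal_linear_post[OF A.module_axioms h Q.module_hom_gen]] by blast
      obtain lt where lt: "conformal_bilinear sQ sA sQ lt" "\<And>a. lt x a = map_poly Q.gen (g a)"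
        using Q.ex_bilinear_left[OF modules
            conformal_linear_post[OF A.module_axioms g Q.module_hom_gen]] by blast
      obtain rt where rt: "conformal_bilinear sQ sA sA rt" "\<And>a. rt x a = T a"
        using Q.ex_bilinear_left[OF A.module_axioms A.module_axioms T] by blast
      obtain f where f: "conformal_bilinear sQ sQ sA f" "f x x = Q0"
        using Q.ex_bilinear_both[OF A.module_axioms] by blast
      obtain circ where circ: "conformal_bilinear sQ sQ sQ circ" "circ x x = map_poly Q.gen P"
        using Q.ex_bilinear_both[OF Q.module_axioms] by blast
      have "\<Phi> (lh, rh, lt, rt, f, circ) = t"
        by (simp add: \<Phi>_def t lh rh lt rt f circ fun_eq_iff)
      \<comment> \<open>The image under \<open>\<Phi>\<close> is the given flag datum, so
        \<open>iff\<close> yields associativity of the lifted product.\<close>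
      moreover have "(lh, rh, lt, rt, f, circ) \<in> TC sA lprod sQ"
        using iff[of lh rh lt rt f circ] \<open>t \<in> _\<close> calculation
        by (simp add: lh rh lt rt f circ)
      ultimately show "t \<in> \<Phi> ` TC sA lprod sQ" by force
    qed
  qed
  then show ?thesis by (rule exI[of _ \<Phi>])
qed

end
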